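(* Let $G\not\equiv 0$ be an infinitesimal generator in $\mathbb{D}$, let $(\phi_t)_{t\ge 0}$ be the associated semigroup of holomorphic self-maps of $\mathbb{D}$ and let $h:\mathbb{D}\to\mathbb{C}$ be the associated K\"onigs function. Let $x\in\partial\mathbb{D}$. Then the following are equivalent: (1) $x$ is a regular pole of $G$; (2) $x$ is a $\beta$-point for $\phi_t$ for some (equivalently, for all) $t>0$; (3) $x$ is a $\beta$-point for $h$.
   Context: $\mathbb{D}$ is the open unit disc in $\mathbb{C}$. A semigroup $(\phi_t)_{t\ge0}$ of holomorphic self-maps of $\mathbb{D}$ is a family of holomorphic maps $\phi_t:\mathbb{D}\to\mathbb{D}$ with $\phi_0=\mathrm{id}$, $\phi_{t+s}=\phi_t\circ\phi_s$, and $t\mapsto\phi_t$ continuous for uniform convergence on compacta. Its infinitesimal generator is the unique holomorphic $G:\mathbb{D}\to\mathbb{C}$ with $\partial_t\phi_t(z)=G(\phi_t(z))$ for all $t\ge 0$, $z\in\mathbb D$; an infinitesimal generator in $\mathbb D$ is a $G$ arising this way. Berkson-Porta formula: if $G\not\equiv0$ there are a unique $\tau\in\overline{\mathbb{D}}$ (the Denjoy-Wolff point) and a unique holomorphic $p:\mathbb{D}\to\mathbb{C}$ with $\mathrm{Re}\,p\ge0$ such that $G(z)=(z-\tau)(\overline{\tau}z-1)p(z)$. K\"onigs function $h$ of $(\phi_t)$ (for $G\not\equiv 0$): the unique univalent $h:\mathbb{D}\to\mathbb{C}$ such that: if $\tau\in\mathbb{D}$, then $h(\tau)=0$, $h'(\tau)=1$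 and $h'(z)G(z)=G'(\tau)h(z)$ for all $z\in\mathbb D$ (so $h\circ\phi_t=e^{G'(\tau)t}h$); if $\tau\in\partial\mathbb{D}$, then $h(0)=0$ and $h'(z)G(z)=1$ for all $z\in\mathbb D$ (so $h\circ\phi_t=h+t$). $\angle\lim$, $\angle\liminf$, $\angle\limsup$ as $z\to x\in\partial\mathbb D$ denote non-tangential limit, lower limit and upper limit, i.e. taken as $z\to x$ inside Stolz angles $\{z\in\mathbb{D}:|x-z|<R(1-|z|)\}$, $R>1$. A point $x\in\partial\mathbb{D}$ is a regular pole of $G$ of mass $C>0$ if $\angle\liminf_{z\to x}|G(z)(x-z)|=C$ with $C\in(0,+\infty)$; it is a regular pole if this holds for some such $C$. For a holomorphic $f:\mathbb{D}\to\mathbb{C}$, a point $x\in\partial\mathbb{D}$ is a $\beta$-point of $f$ if $\angle\limsup_{z\to x}\frac{|f'(z)|}{|x-z|}=L<+\infty$. *)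

theory Defs
  imports "HOL-Complex_Analysis.Complex_Analysis"
begin

abbreviation unit_disc :: "complex set" where
  "unit_disc \<equiv> ball 0 1"

text \<open>Maps on the disc are total functions on the complex numbers; only their values on the disc
  are ever constrained or used.\<close>

definition holomorphic_semigroup :: "(real \<Rightarrow> complex \<Rightarrow> complex) \<Rightarrow> bool" where
  "holomorphic_semigroup \<phi> \<longleftrightarrow>
     (\<forall>t\<ge>0. \<phi> t holomorphic_on unit_disc \<and> \<phi> t ` unit_disc \<subseteq> unit_disc) \<and>
     (\<forall>z\<in>unit_disc. \<phi> 0 z = z) \<and>
     (\<forall>t\<ge>0. \<forall>s\<ge>0. \<forall>z\<in>unit_disc. \<phi> (t + s) z = \<phi> t (\<phi> s z)) \<and>
     (\<forall>t\<ge>0. \<forall>K. compact K \<and> K \<subseteq> unit_disc \<longrightarrow>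
        uniform_limit K \<phi> (\<phi> t) (at t within {0..}))"

text \<open>The derivative in time is one-sided at time zero.\<close>

definition generator_of :: "(real \<Rightarrow> complex \<Rightarrow> complex) \<Rightarrow> (complex \<Rightarrow> complex) \<Rightarrow> bool" where
  "generator_of \<phi> G \<longleftrightarrow>
     G holomorphic_on unit_disc \<and>
     (\<forall>t\<ge>0. \<forall>z\<in>unit_disc.
        ((\<lambda>s. \<phi> s z) has_vector_derivative G (\<phi> t z)) (at t within {0..}))"

text \<open>For a generator that is not identically zero, the Berkson--Porta formula says that there is
  exactly one such point.\<close>

definition denjoy_wolff_point :: "(complex \<Rightarrow> complex) \<Rightarrow> complex \<Rightarrow> bool" where
  "denjoy_wolff_point G \<tau> \<longleftrightarrow>
     \<tau> \<in> cball 0 1 \<and>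
     (\<exists>p. p holomorphic_on unit_disc \<and>
        (\<forall>z\<in>unit_disc. 0 \<le> Re (p z) \<and> G z = (z - \<tau>) * (cnj \<tau> * z - 1) * p z))"

definition koenigs_function :: "(complex \<Rightarrow> complex) \<Rightarrow> (complex \<Rightarrow> complex) \<Rightarrow> bool" where
  "koenigs_function G h \<longleftrightarrow>
     h holomorphic_on unit_disc \<and> inj_on h unit_disc \<and>
     (\<exists>\<tau>. denjoy_wolff_point G \<tau> \<and>
        (if \<tau> \<in> unit_disc
         then h \<tau> = 0 \<and> deriv h \<tau> = 1 \<and> (\<forall>z\<in>unit_disc. deriv h z * G z = deriv G \<tau> * h z)
         else h 0 = 0 \<and> (\<forall>z\<in>unit_disc. deriv h z * G z = 1)))"

definition stolz_angle :: "complex \<Rightarrow> real \<Rightarrow> complex set" where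
  "stolz_angle x R = {z \<in> unit_disc. cmod (x - z) < R * (1 - cmod z)}"

text \<open>The Stolz angles at \<open>x\<close> increase with \<open>R\<close>, so the non-tangential lower (upper) limit is the
  infimum (supremum) of the lower (upper) limits inside the single angles, that is, the least
  (greatest) limit over all sequences tending to \<open>x\<close> inside some Stolz angle.\<close>

definition angular_liminf :: "(complex \<Rightarrow> real) \<Rightarrow> complex \<Rightarrow> ereal" where
  "angular_liminf f x =
     (INF R\<in>{1<..}. Liminf (at x within stolz_angle x R) (\<lambda>z. ereal (f z)))"

definition angular_limsup :: "(complex \<Rightarrow> real) \<Rightarrow> complex \<Rightarrow> ereal" where
  "angular_limsup f x =
     (SUP R\<in>{1<..}. Limsup (at x within stolz_angle x R) (\<lambda>z. ereal (f z)))"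

definition regular_pole_of_mass :: "(complex \<Rightarrow> complex) \<Rightarrow> complex \<Rightarrow> real \<Rightarrow> bool" where
  "regular_pole_of_mass G x C \<longleftrightarrow>
     C > 0 \<and> angular_liminf (\<lambda>z. cmod (G z * (x - z))) x = ereal C"

definition regular_pole :: "(complex \<Rightarrow> complex) \<Rightarrow> complex \<Rightarrow> bool" where
  "regular_pole G x \<longleftrightarrow> (\<exists>C. regular_pole_of_mass G x C)"

definition beta_point :: "(complex \<Rightarrow> complex) \<Rightarrow> complex \<Rightarrow> bool" where
  "beta_point f x \<longleftrightarrow> angular_limsup (\<lambda>z. cmod (deriv f z) / cmod (x - z)) x < \<infinity>"

end

theory Submission
  imports Defs
begin

text \<open>The Julia--Wolff--Caratheodory argument for the Berkson--Porta factor \<open>p\<close> shows that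
  \<open>G z * (x - z)\<close> always has an angular limit \<open>- c x\<^sup>2\<close> with \<open>c \<ge> 0\<close>, so \<open>x\<close> is a regular pole
  exactly when \<open>c > 0\<close>. If \<open>c > 0\<close>, then \<open>h\<close> has an angular limit \<open>y\<close> at \<open>x\<close>, and since it is
  quadratic there, the image of a Stolz angle meets the flow line through \<open>y\<close> arbitrarily close to
  \<open>y\<close>; hence the flow moves \<open>y\<close> into the image of \<open>h\<close> in arbitrarily short time, and \<open>\<phi>\<^sub>t\<close> has an angular limit
  inside the disc. Both quotients \<open>\<bar>h'\<bar> / \<bar>x - z\<bar>\<close> and \<open>\<bar>\<phi>\<^sub>t'\<bar> / \<bar>x - z\<bar>\<close> then converge, by
  \<open>h' G = l h + b\<close> and \<open>h' (\<phi>\<^sub>t z) \<phi>\<^sub>t' z = e\<^sup>l\<^sup>t h' z\<close>. Conversely, a map of the disc with a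
  \<open>\<beta>\<close>-point at \<open>x\<close> has an angular limit there, which cannot lie on the circle because of the
  same Julia--Wolff--Caratheodory argument; so a \<open>\<beta>\<close>-point of \<open>\<phi>\<^sub>t\<close> gives \<open>h' = O(x - z)\<close>, which
  forces \<open>c > 0\<close> because \<open>l h + b\<close> stays away from zero.\<close>

section \<open>Schwarz--Pick inequality for the half plane\<close>

text \<open>For \<open>Re v > 0\<close> this says that the Cayley transform
  \<open>(u - v) / (u + cnj v)\<close> takes the right half plane into the unit disc.\<close>

lemma cmod_diff_cnj_identity:
  "(cmod (u + cnj v))\<^sup>2 - (cmod (u - v))\<^sup>2 = 4 * Re u * Re v"
  unfolding cmod_power2 by (simp add: power2_eq_square algebra_simps)

text \<open>The counterpart in the disc, for the pseudohyperbolic quotient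
  \<open>(z - w) / (1 - cnj w * z)\<close>.\<close>

lemma pseudohyperbolic_identity:
  "(cmod (1 - cnj w * z))\<^sup>2 - (cmod (z - w))\<^sup>2 = (1 - (cmod z)\<^sup>2) * (1 - (cmod w)\<^sup>2)"
  unfolding cmod_power2 by (simp add: power2_eq_square algebra_simps)

lemma one_minus_cnj_mult_nonzero:
  assumes "cmod w < 1" "cmod z \<le> 1"
  shows "1 - cnj w * z \<noteq> 0"
proof
  assume "1 - cnj w * z = 0"
  then have "cmod w * cmod z = 1"
    by (metis complex_mod_cnj eq_iff_diff_eq_0 norm_mult norm_one)
  moreover have "cmod w * cmod z \<le> cmod w * 1"
    using assms by (intro mult_left_mono) auto
  ultimately show False using assms by simp
qed

text \<open>The Schwarz lemma for \<open>p\<close> conjugated to a self-map of the disc fixing 0, by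
  a Moebius map in the source and a Cayley transform centred at \<open>p w\<close> in the target.
  Squaring the result and inserting the two identities gives a form without quotients.\<close>

lemma Schwarz_Pick_half_plane_strict:
  assumes hol: "p holomorphic_on unit_disc"
    and pos: "\<And>z. z \<in> unit_disc \<Longrightarrow> 0 < Re (p z)"
    and z: "z \<in> unit_disc" and w: "w \<in> unit_disc"
  shows "(cmod (p z + cnj (p w)))\<^sup>2 * ((1 - (cmod z)\<^sup>2) * (1 - (cmod w)\<^sup>2))
           \<le> 4 * Re (p z) * Re (p w) * (cmod (1 - cnj w * z))\<^sup>2"
proof -
  \<comment> \<open>\<open>n\<close> is the disc automorphism taking 0 to \<open>w\<close>, and
    \<open>s\<close> is the point that it takes to \<open>z\<close>.\<close>
  define n where "n = Moebius_function 0 (- w)"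
  define g where "g = (\<lambda>s. (p (n s) - p w) / (p (n s) + cnj (p w)))"
  define s where "s = (z - w) / (1 - cnj w * z)"
  have w1: "cmod (- w) < 1" using w by simp
  have nin: "n v \<in> unit_disc" if "cmod v < 1" for v
    using Moebius_function_norm_lt_1[OF w1 that] by (simp add: n_def)
  have nz: "p (n v) + cnj (p w) \<noteq> 0" if "cmod v < 1" for v
  proof -
    have "Re (p (n v) + cnj (p w)) > 0"
      using pos[OF nin[OF that]] pos[OF w] by simp
    then show ?thesis by (metis less_irrefl zero_complex.simps(1))
  qed
  have "n holomorphic_on unit_disc"
    unfolding n_def by (rule Moebius_function_holomorphic[OF w1])
  then have "(p \<circ> n) holomorphic_on unit_disc"
    by (rule holomorphic_on_compose_gen[OF _ hol]) (use nin in auto)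
  then have hg: "g holomorphic_on unit_disc"
    unfolding g_def using nz by (intro holomorphic_intros) (auto simp: o_def)
  have g0: "g 0 = 0"
    by (simp add: g_def n_def Moebius_function_of_zero)
  have g1: "cmod (g v) < 1" if "cmod v < 1" for v
  proof -
    have "(cmod (p (n v) - p w))\<^sup>2 < (cmod (p (n v) + cnj (p w)))\<^sup>2"
      using cmod_diff_cnj_identity[of "p (n v)" "p w"] pos[OF nin[OF that]] pos[OF w]
      by (smt (verit) mult_pos_pos)
    then have "cmod (p (n v) - p w) < cmod (p (n v) + cnj (p w))"
      by (rule power2_less_imp_less) simp
    then show ?thesis using nz[OF that] by (simp add: g_def norm_divide)
  qed
  have D: "1 - cnj w * z \<noteq> 0"
    using w z by (intro one_minus_cnj_mult_nonzero) auto
  have s1: "cmod s < 1"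
    using Moebius_function_norm_lt_1[of w z 0] w z by (simp add: s_def Moebius_function_simple)
  have ns: "n s = z"
    using Moebius_function_compose[of "- w" w z] w z
    by (simp add: n_def s_def Moebius_function_simple)
  have "cmod (g s) \<le> cmod s"
    by (rule Schwarz_Lemma(1)[OF hg g0 g1 s1])
  moreover have "cmod (g s) = cmod (p z - p w) / cmod (p z + cnj (p w))"
    by (simp add: g_def ns norm_divide)
  moreover have "cmod s = cmod (z - w) / cmod (1 - cnj w * z)"
    by (simp add: s_def norm_divide)
  moreover have "cmod (p z + cnj (p w)) > 0"
    using nz[OF s1] ns by simp
  moreover have "cmod (1 - cnj w * z) > 0"
    using D by simp
  ultimately have "cmod (p z - p w) * cmod (1 - cnj w * z) \<le> cmod (z - w) * cmod (p z + cnj (p w))"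
    by (simp only: pos_divide_le_eq times_divide_eq_left pos_le_divide_eq)
  then have "(cmod (p z - p w) * cmod (1 - cnj w * z))\<^sup>2 \<le> (cmod (z - w) * cmod (p z + cnj (p w)))\<^sup>2"
    by (intro power_mono) auto
  then show ?thesis
    unfolding pseudohyperbolic_identity[symmetric]
    using cmod_diff_cnj_identity[of "p z" "p w"]
    by (simp add: power_mult_distrib algebra_simps)
qed

text \<open>The strict version holds for \<open>p + e\<close> with \<open>e > 0\<close>, and both
  sides are continuous in \<open>e\<close>.\<close>

lemma Schwarz_Pick_half_plane:
  assumes hol: "p holomorphic_on unit_disc"
    and nonneg: "\<And>z. z \<in> unit_disc \<Longrightarrow> 0 \<le> Re (p z)"
    and z: "z \<in> unit_disc" and w: "w \<in> unit_disc"
  shows "(cmod (p z + cnj (p w)))\<^sup>2 * ((1 - (cmod z)\<^sup>2) * (1 - (cmod w)\<^sup>2))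
           \<le> 4 * Re (p z) * Re (p w) * (cmod (1 - cnj w * z))\<^sup>2"
proof -
  let ?l = "\<lambda>e. (cmod ((p z + of_real e) + cnj (p w + of_real e)))\<^sup>2
                  * ((1 - (cmod z)\<^sup>2) * (1 - (cmod w)\<^sup>2))"
  let ?r = "\<lambda>e. 4 * Re (p z + of_real e) * Re (p w + of_real e) * (cmod (1 - cnj w * z))\<^sup>2"
  have "eventually (\<lambda>e. ?l e \<le> ?r e) (at_right (0::real))"
    unfolding eventually_at_right_field
  proof (intro exI[of _ 1] conjI allI impI)
    fix e :: real assume "0 < e" "e < 1"
    then show "?l e \<le> ?r e"
      using nonneg by (intro Schwarz_Pick_half_plane_strict[of "\<lambda>z. p z + of_real e"] hol z w
          holomorphic_intros) (auto simp: add_nonneg_pos)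
  qed auto
  moreover have "(?l \<longlongrightarrow> ?l 0) (at_right 0)" "(?r \<longlongrightarrow> ?r 0) (at_right 0)"
    by (auto intro!: tendsto_eq_intros)
  ultimately have "?l 0 \<le> ?r 0"
    by (intro tendsto_le[where F="at_right (0::real)"]) auto
  then show ?thesis by simp
qed

section \<open>Stolz angles\<close>

lemma stolz_angle_mono: "R \<le> R' \<Longrightarrow> stolz_angle x R \<subseteq> stolz_angle x R'"
  unfolding stolz_angle_def
  by (auto intro: less_le_trans mult_right_mono)

lemma open_stolz_angle: "open (stolz_angle x R)"
  unfolding stolz_angle_def Collect_conj_eq Collect_mem_eq
  by (intro open_Int open_ball open_Collect_less continuous_intros)

text \<open>A Stolz angle is the part of the disc in a strict sublevel set of the convex function
  \<open>cmod (x - z) + R * cmod z\<close>.\<close>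

lemma convex_stolz_angle:
  assumes "0 < R"
  shows "convex (stolz_angle x R)"
proof -
  let ?f = "\<lambda>z. dist x z + R * dist 0 z"
  have cf: "convex_on UNIV ?f"
    using assms by (intro convex_on_add convex_on_cmul convex_on_dist) auto
  have "convex {z\<in>UNIV. ?f z < R}"
  proof (rule convexI)
    fix v w and s t :: real
    assume vw: "v \<in> {z\<in>UNIV. ?f z < R}" "w \<in> {z\<in>UNIV. ?f z < R}"
      and st: "0 \<le> s" "0 \<le> t" "s + t = 1"
    have "?f (s *\<^sub>R v + t *\<^sub>R w) \<le> max (?f v) (?f w)"
      by (rule convex_lower[OF cf _ _ st]) auto
    then show "s *\<^sub>R v + t *\<^sub>R w \<in> {z\<in>UNIV. ?f z < R}"
      using vw by simp
  qed
  then have "convex (ball 0 1 \<inter> {z\<in>UNIV. ?f z < R})"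
    by (intro convex_Int) auto
  also have "ball 0 1 \<inter> {z\<in>UNIV. dist x z + R * dist 0 z < R} = stolz_angle x R"
    by (auto simp: stolz_angle_def dist_norm algebra_simps)
  finally show ?thesis .
qed

text \<open>The radius ending at \<open>x\<close> lies in the angle near \<open>x\<close>: there the
  distances to \<open>x\<close> and to the circle agree, and \<open>R > 1\<close>.\<close>

lemma islimpt_stolz_angle:
  assumes x: "cmod x = 1" and R: "1 < R"
  shows "x islimpt stolz_angle x R"
  unfolding islimpt_approachable
proof (intro allI impI)
  fix e :: real assume e: "e > 0"
  define r where "r = min (e/2) (1/2)"
  have r: "0 < r" "r < 1" "r < e" using e by (auto simp: r_def)
  define z where "z = of_real (1 - r) * x"
  have xz: "x - z = of_real r * x" by (simp add: z_def algebra_simps)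
  have 1: "cmod (x - z) = r" unfolding xz norm_mult using x r by simp
  have 2: "cmod z = 1 - r" unfolding z_def norm_mult norm_of_real using x r by simp
  have "z \<in> stolz_angle x R" using 1 2 r R by (auto simp: stolz_angle_def)
  moreover have "z \<noteq> x" using 1 r by auto
  moreover have "dist z x < e" using 1 r by (simp add: dist_norm norm_minus_commute)
  ultimately show "\<exists>x'\<in>stolz_angle x R. x' \<noteq> x \<and> dist x' x < e" by blast
qed

lemma at_within_stolz_angle_nontrivial:
  assumes "cmod x = 1" "1 < R"
  shows "at x within stolz_angle x R \<noteq> bot"
  using islimpt_stolz_angle[OF assms] by (simp add: trivial_limit_within)

lemma stolz_angle_subset_disc: "stolz_angle x R \<subseteq> unit_disc"
  by (auto simp: stolz_angle_def)

lemma not_in_stolz_angle: "cmod x = 1 \<Longrightarrow> x \<notin> stolz_angle x R"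
  by (auto simp: stolz_angle_def)

lemma eventually_at_stolz_angle:
  assumes "cmod x = 1"
  shows "eventually P (at x within stolz_angle x R) \<longleftrightarrow>
           (\<exists>d>0. \<forall>z \<in> stolz_angle x R \<inter> ball x d. P z)"
  unfolding eventually_at
  by (rule ex_cong1) (use not_in_stolz_angle[OF assms] in \<open>auto simp: dist_commute\<close>)

lemma eventually_in_stolz_angle: "eventually (\<lambda>z. z \<in> stolz_angle x R) (at x within stolz_angle x R)"
  by (simp add: eventually_at_filter)

text \<open>Stolz angles are nested, so the limits for the apertures \<open>R\<close> and 2 both
  agree with the one for \<open>max R 2\<close>.\<close>

lemma angular_tendsto_ex_common:
  fixes f :: "complex \<Rightarrow> 'a :: t2_space"
  assumes x: "cmod x = 1"
    and ex: "\<And>R. 1 < R \<Longrightarrow> \<exists>l. (f \<longlongrightarrow> l) (at x within stolz_angle x R)"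
  shows "\<exists>l. \<forall>R>1. (f \<longlongrightarrow> l) (at x within stolz_angle x R)"
proof -
  obtain l where l: "(f \<longlongrightarrow> l) (at x within stolz_angle x 2)" using ex[of 2] by auto
  have "(f \<longlongrightarrow> l) (at x within stolz_angle x R)" if R: "1 < R" for R
  proof -
    obtain k where k: "(f \<longlongrightarrow> k) (at x within stolz_angle x (max R 2))"
      using ex[of "max R 2"] by (metis less_max_iff_disj R)
    then have "(f \<longlongrightarrow> k) (at x within stolz_angle x 2)"
      by (rule tendsto_within_subset) (simp add: stolz_angle_mono)
    then have "k = l"
      using l at_within_stolz_angle_nontrivial[OF x, of 2] tendsto_unique by auto
    then show ?thesis
      using tendsto_within_subset[OF k stolz_angle_mono[of R "max R 2" x]] by simp
  qed
  then show ?thesis by blast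
qed

text \<open>The segment from \<open>z\<close> to a point closer to \<open>x\<close> stays in the convex set
  \<open>stolz_angle x R \<inter> cball x (cmod (x - z))\<close>.\<close>

lemma angular_limit_of_small_derivative:
  assumes x: "cmod x = 1" and R: "1 < R" and d: "d > 0" and \<eta>: "0 \<le> \<eta>"
    and der: "\<And>z. z \<in> stolz_angle x R \<inter> ball x d \<Longrightarrow> (F has_field_derivative F' z) (at z)"
    and bound: "\<And>z. z \<in> stolz_angle x R \<inter> ball x d \<Longrightarrow> cmod (F' z) \<le> \<eta> * cmod (x - z)"
  shows "\<exists>y. (F \<longlongrightarrow> y) (at x within stolz_angle x R) \<and>
           (\<forall>z \<in> stolz_angle x R \<inter> ball x d. cmod (F z - y) \<le> \<eta> * (cmod (x - z))\<^sup>2)"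
proof -
  let ?S = "stolz_angle x R"
  \<comment> \<open>As \<open>w\<close> is no farther from \<open>x\<close> than \<open>z\<close>,
    the whole segment satisfies the derivative bound with the value at \<open>z\<close>.\<close>
  have local: "cmod (F z - F w) \<le> \<eta> * cmod (x - z) * cmod (z - w)"
    if z: "z \<in> ?S \<inter> ball x d" and w: "w \<in> ?S" "cmod (x - w) \<le> cmod (x - z)" for z w
  proof (rule field_differentiable_bound[where S = "?S \<inter> cball x (cmod (x - z))" and f' = F'])
    show "convex (?S \<inter> cball x (cmod (x - z)))"
      using R by (intro convex_Int convex_stolz_angle) auto
    fix v assume v: "v \<in> ?S \<inter> cball x (cmod (x - z))"
    then have v': "v \<in> ?S \<inter> ball x d" using z by (auto simp: dist_norm)
    show "(F has_field_derivative F' v) (at v within ?S \<inter> cball x (cmod (x - z)))"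
      using der[OF v'] has_field_derivative_at_within by blast
    show "cmod (F' v) \<le> \<eta> * cmod (x - z)"
      using bound[OF v'] v \<eta> by (smt (verit) IntE dist_norm mem_cball mult_left_mono)
  qed (use z w in \<open>auto simp: dist_norm\<close>)
  \<comment> \<open>A Lipschitz bound with a single constant gives uniform continuity, hence a limit
    at the closure point \<open>x\<close>.\<close>
  have lip: "cmod (F z - F w) \<le> \<eta> * d * cmod (z - w)"
    if z: "z \<in> ?S \<inter> ball x d" and w: "w \<in> ?S \<inter> ball x d" for z w
  proof -
    have *: "\<eta> * cmod (x - v) * cmod (z - w) \<le> \<eta> * d * cmod (z - w)" if "v \<in> ball x d" for v
      using that \<eta> by (intro mult_right_mono mult_left_mono) (auto simp: dist_norm)
    consider "cmod (x - w) \<le> cmod (x - z)" | "cmod (x - z) \<le> cmod (x - w)" by linarith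
    then show ?thesis
    proof cases
      case 1 then show ?thesis using local[OF z, of w] w *[of z] z by auto
    next
      case 2 then show ?thesis using local[OF w, of z] z *[of w] w by (auto simp: norm_minus_commute)
    qed
  qed
  have eqf: "at x within (?S \<inter> ball x d) = at x within ?S"
    using d by (intro at_within_nhd[where S = "ball x d"]) auto
  have "uniformly_continuous_on (?S \<inter> ball x d) F"
    unfolding uniformly_continuous_on_def
  proof (intro allI impI)
    fix e :: real assume e: "e > 0"
    \<comment> \<open>The summand 1 keeps the denominator positive when \<open>\<eta>\<close> is
      0.\<close>
    have "dist (F z) (F w) < e" if "z \<in> ?S \<inter> ball x d" "w \<in> ?S \<inter> ball x d"
      "dist z w < e / (\<eta> * d + 1)" for z w
    proof -
      have "\<eta> * d \<ge> 0" using \<eta> d by simp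
      then have "(\<eta> * d + 1) * cmod (z - w) < e" using that(3)
        by (simp add: dist_norm field_simps)
      moreover have "\<eta> * d * cmod (z - w) \<le> (\<eta> * d + 1) * cmod (z - w)"
        by (intro mult_right_mono) auto
      ultimately show ?thesis using lip[OF that(1,2)] by (simp add: dist_norm)
    qed
    moreover have "e / (\<eta> * d + 1) > 0" using e \<eta> d by (intro divide_pos_pos add_nonneg_pos) auto
    ultimately show "\<exists>da>0. \<forall>z\<in>?S \<inter> ball x d. \<forall>w\<in>?S \<inter> ball x d. dist w z < da \<longrightarrow> dist (F w) (F z) < e"
      by blast
  qed
  moreover have "x islimpt ?S \<inter> ball x d"
    using at_within_stolz_angle_nontrivial[OF x R] eqf by (metis trivial_limit_within)
  then have "x \<in> closure (?S \<inter> ball x d)"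
    by (simp add: closure_def)
  ultimately obtain y where y: "(F \<longlongrightarrow> y) (at x within (?S \<inter> ball x d))"
    using uniformly_continuous_on_extension_at_closure by blast
  then have y: "(F \<longlongrightarrow> y) (at x within ?S)" by (simp add: eqf)
  have "cmod (F z - y) \<le> \<eta> * (cmod (x - z))\<^sup>2" if z: "z \<in> ?S \<inter> ball x d" for z
  proof -
    have "((\<lambda>w. \<eta> * cmod (x - z) * cmod (z - w)) \<longlongrightarrow> \<eta> * cmod (x - z) * cmod (z - x)) (at x within ?S)"
      by (intro tendsto_intros)
    moreover have "((\<lambda>w. cmod (F z - F w)) \<longlongrightarrow> cmod (F z - y)) (at x within ?S)"
      by (intro tendsto_intros y)
    \<comment> \<open>Points \<open>w\<close> close to \<open>x\<close> are nearer to it than the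
      fixed \<open>z\<close>, so \<open>local\<close> passes to the limit and yields the quadratic
      rate.\<close>
    moreover have "eventually (\<lambda>w. cmod (F z - F w) \<le> \<eta> * cmod (x - z) * cmod (z - w)) (at x within ?S)"
      unfolding eventually_at_stolz_angle[OF x]
    proof (intro exI conjI ballI)
      have "z \<noteq> x" using not_in_stolz_angle[OF x] z by auto
      then show "cmod (x - z) > 0" by simp
      fix w assume "w \<in> ?S \<inter> ball x (cmod (x - z))"
      then show "cmod (F z - F w) \<le> \<eta> * cmod (x - z) * cmod (z - w)"
        by (intro local[OF z]) (auto simp: dist_norm)
    qed
    ultimately have "cmod (F z - y) \<le> \<eta> * cmod (x - z) * cmod (z - x)"
      using at_within_stolz_angle_nontrivial[OF x R] by (intro tendsto_le)
    then show ?thesis by (simp add: power2_eq_square norm_minus_commute mult.assoc)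
  qed
  with y show ?thesis by blast
qed

section \<open>Angular limits\<close>

lemma Re_Poisson_kernel:
  assumes "cmod x = 1"
  shows "Re ((x + z) / (x - z)) = (1 - (cmod z)\<^sup>2) / (cmod (x - z))\<^sup>2"
proof -
  have "Re ((x + z) * cnj (x - z)) = (cmod x)\<^sup>2 - (cmod z)\<^sup>2"
    unfolding cmod_power2 by (simp add: power2_eq_square algebra_simps)
  then show ?thesis
    using assms by (simp add: complex_div_cnj[of "x + z" "x - z"] del: of_real_power flip: of_real_power)
qed

text \<open>Schwarz--Pick is applied with a fixed \<open>w\<close> at which \<open>Re q\<close> is
  tiny compared with the Poisson kernel. In a Stolz angle \<open>cmod (x - z)\<close> is at most
  \<open>R * (1 - (cmod z)\<^sup>2)\<close>, which absorbs the factor lost at the boundary.\<close>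

lemma angular_limit_half_plane_vanishing:
  assumes hol: "q holomorphic_on unit_disc"
    and nonneg: "\<And>z. z \<in> unit_disc \<Longrightarrow> 0 \<le> Re (q z)"
    and x: "cmod x = 1" and R: "1 < R"
    and inf: "\<And>e. e > 0 \<Longrightarrow> \<exists>w\<in>unit_disc. Re (q w) * (cmod (x - w))\<^sup>2 < e * (1 - (cmod w)\<^sup>2)"
  shows "((\<lambda>z. (x - z) * q z) \<longlongrightarrow> 0) (at x within stolz_angle x R)"
proof (rule tendstoI)
  fix e :: real assume e: "e > 0"
  \<comment> \<open>The main term of the final estimate tends to \<open>4 * \<epsilon> * R\<close>,
    which is \<open>e / 4\<close>.\<close>
  define \<epsilon> where "\<epsilon> = e / (16 * R)"
  have \<epsilon>: "\<epsilon> > 0" using e R by (simp add: \<epsilon>_def)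
  obtain w where w: "w \<in> unit_disc"
    and qw: "Re (q w) * (cmod (x - w))\<^sup>2 < \<epsilon> * (1 - (cmod w)\<^sup>2)"
    using inf[OF \<epsilon>] by auto
  let ?N = "\<lambda>z. cmod (1 - cnj w * z)"
  have xw: "x \<noteq> w" using x w by auto
  have w2: "1 - (cmod w)\<^sup>2 > 0" using w by (simp add: power_less_one_iff abs_square_less_1)
  have "x * cnj x = 1" using x complex_norm_square[of x] by simp
  then have "1 - cnj w * x = x * cnj (x - w)" by (simp add: algebra_simps)
  then have Nx: "?N x = cmod (x - w)" using x by (simp add: norm_mult del: complex_cnj_diff)
  have main: "cmod (x - z) * cmod (q z) \<le>
      4 * \<epsilon> * R * ((?N z)\<^sup>2 / (cmod (x - w))\<^sup>2) + cmod (x - z) * cmod (q w)"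
    if z: "z \<in> stolz_angle x R" for z
  proof -
    have zd: "z \<in> unit_disc" and zR: "cmod (x - z) < R * (1 - cmod z)"
      using z by (auto simp: stolz_angle_def)
    define S where "S = cmod (q z + cnj (q w))"
    define Z where "Z = 1 - (cmod z)\<^sup>2"
    define W where "W = 1 - (cmod w)\<^sup>2"
    have Z0: "Z > 0" using zd by (simp add: Z_def abs_square_less_1)
    have W0: "W > 0" using w2 by (simp add: W_def)
    have "(cmod z)\<^sup>2 \<le> cmod z * 1" using zd unfolding power2_eq_square by (intro mult_left_mono) auto
    then have "1 - cmod z \<le> Z" by (simp add: Z_def)
    then have ZR: "cmod (x - z) \<le> R * Z"
      using zR R by (smt (verit) mult_left_mono)
    have "S\<^sup>2 * (Z * W) \<le> 4 * Re (q z) * Re (q w) * (?N z)\<^sup>2"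
      unfolding S_def Z_def W_def by (rule Schwarz_Pick_half_plane[OF hol nonneg zd w])
    \<comment> \<open>Replacing \<open>Re (q z)\<close> by \<open>S\<close> allows one factor
      \<open>S\<close> to cancel, so that the estimate becomes linear in \<open>S\<close>.\<close>
    also have "\<dots> \<le> 4 * S * Re (q w) * (?N z)\<^sup>2"
    proof -
      have "Re (q z) \<le> S"
        using complex_Re_le_cmod[of "q z + cnj (q w)"] nonneg[OF w] by (simp add: S_def)
      then show ?thesis using nonneg[OF w] by (intro mult_right_mono mult_left_mono) auto
    qed
    finally have *: "S * (S * (Z * W)) \<le> S * (4 * Re (q w) * (?N z)\<^sup>2)"
      by (simp add: power2_eq_square algebra_simps)
    have "S * (Z * W) \<le> 4 * Re (q w) * (?N z)\<^sup>2"
    proof (cases "S = 0")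
      case True then show ?thesis using nonneg[OF w] by simp
    next
      case False
      then have "S > 0" by (simp add: S_def)
      then show ?thesis using * by (simp only: mult_le_cancel_left_pos)
    qed
    then have "S * (Z * W) * (cmod (x - w))\<^sup>2 \<le> 4 * Re (q w) * (?N z)\<^sup>2 * (cmod (x - w))\<^sup>2"
      by (rule mult_right_mono) simp
    also have "\<dots> = 4 * (Re (q w) * (cmod (x - w))\<^sup>2) * (?N z)\<^sup>2"
      by (simp only: mult_ac)
    also have "\<dots> \<le> 4 * (\<epsilon> * W) * (?N z)\<^sup>2"
      using qw by (intro mult_right_mono mult_left_mono) (auto simp: W_def)
    finally have "W * (S * Z * (cmod (x - w))\<^sup>2) \<le> W * (4 * \<epsilon> * (?N z)\<^sup>2)"
      by (simp add: algebra_simps)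
    then have "S * Z * (cmod (x - w))\<^sup>2 \<le> 4 * \<epsilon> * (?N z)\<^sup>2"
      using W0 by (simp only: mult_le_cancel_left_pos)
    then have SZ: "S * Z \<le> 4 * \<epsilon> * ((?N z)\<^sup>2 / (cmod (x - w))\<^sup>2)"
      using xw by (simp add: field_simps)
    have "cmod (x - z) * S \<le> R * Z * S" using ZR by (intro mult_right_mono) (auto simp: S_def)
    also have "\<dots> \<le> R * (4 * \<epsilon> * ((?N z)\<^sup>2 / (cmod (x - w))\<^sup>2))"
      using mult_left_mono[OF SZ, of R] R by (simp only: mult_ac)
    finally have A: "cmod (x - z) * S \<le> 4 * \<epsilon> * R * ((?N z)\<^sup>2 / (cmod (x - w))\<^sup>2)"
      by (simp add: algebra_simps)
    have "cmod (q z) \<le> S + cmod (q w)"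
      using norm_triangle_ineq4[of "q z + cnj (q w)" "cnj (q w)"] by (simp add: S_def)
    then have "cmod (x - z) * cmod (q z) \<le> cmod (x - z) * S + cmod (x - z) * cmod (q w)"
      by (simp add: mult_left_mono flip: distrib_left)
    then show ?thesis using A by linarith
  qed
  have "((\<lambda>z. 4 * \<epsilon> * R * ((?N z)\<^sup>2 / (cmod (x - w))\<^sup>2) + cmod (x - z) * cmod (q w)) \<longlongrightarrow>
      4 * \<epsilon> * R * ((?N x)\<^sup>2 / (cmod (x - w))\<^sup>2) + cmod (x - x) * cmod (q w))
      (at x within stolz_angle x R)"
    using xw by (intro tendsto_intros) auto
  moreover have "4 * \<epsilon> * R * ((?N x)\<^sup>2 / (cmod (x - w))\<^sup>2) + cmod (x - x) * cmod (q w) < e"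
    using xw R e by (simp add: Nx \<epsilon>_def)
  ultimately have "eventually (\<lambda>z. 4 * \<epsilon> * R * ((?N z)\<^sup>2 / (cmod (x - w))\<^sup>2)
      + cmod (x - z) * cmod (q w) < e) (at x within stolz_angle x R)"
    by (rule order_tendstoD)
  with eventually_in_stolz_angle
  show "eventually (\<lambda>z. dist ((x - z) * q z) 0 < e) (at x within stolz_angle x R)"
    by eventually_elim (use main in \<open>fastforce simp: norm_mult\<close>)
qed

text \<open>Subtracting the largest multiple of the Poisson kernel at \<open>x\<close> that leaves the real part
  nonnegative reduces to the preceding lemma.\<close>

lemma angular_limit_half_plane:
  assumes hol: "p holomorphic_on unit_disc"
    and nonneg: "\<And>z. z \<in> unit_disc \<Longrightarrow> 0 \<le> Re (p z)"
    and x: "cmod x = 1"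
  shows "\<exists>a\<ge>0. \<forall>R>1. ((\<lambda>z. (x - z) * p z) \<longlongrightarrow> of_real (2 * a) * x) (at x within stolz_angle x R)"
proof -
  \<comment> \<open>\<open>Q\<close> is the quotient of \<open>Re p\<close> and the Poisson kernel
    at \<open>x\<close>, so its infimum \<open>a\<close> is the largest multiple that can be
    subtracted.\<close>
  define Q where "Q z = Re (p z) * (cmod (x - z))\<^sup>2 / (1 - (cmod z)\<^sup>2)" for z
  define a where "a = (INF z\<in>unit_disc. Q z)"
  define q where "q z = p z - of_real a * ((x + z) / (x - z))" for z
  have pos: "1 - (cmod z)\<^sup>2 > 0" "x - z \<noteq> 0" "(cmod (x - z))\<^sup>2 > 0" if "z \<in> unit_disc" for z
    using that x by (auto simp: abs_square_less_1)
  have Q0: "Q z \<ge> 0" if "z \<in> unit_disc" for z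
    using nonneg[OF that] pos[OF that] by (simp add: Q_def)
  have bdd: "bdd_below (Q ` unit_disc)" using Q0 by (intro bdd_belowI[of _ 0]) auto
  have a0: "a \<ge> 0" unfolding a_def using Q0 by (intro cINF_greatest) auto
  have Req: "Re (q z) = Re (p z) - a * ((1 - (cmod z)\<^sup>2) / (cmod (x - z))\<^sup>2)" for z
    unfolding q_def minus_complex.sel times_complex.sel Re_complex_of_real Im_complex_of_real
      Re_Poisson_kernel[OF x] by simp
  have ReqQ: "Re (q z) * (cmod (x - z))\<^sup>2 = (Q z - a) * (1 - (cmod z)\<^sup>2)" if "z \<in> unit_disc" for z
    using pos[OF that] by (simp add: Req Q_def field_simps)
  have qnonneg: "0 \<le> Re (q z)" if z: "z \<in> unit_disc" for z
  proof -
    have "a \<le> Q z" unfolding a_def using bdd z by (intro cINF_lower) auto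
    then have "0 \<le> Re (q z) * (cmod (x - z))\<^sup>2" using ReqQ[OF z] pos[OF z] by simp
    then show ?thesis using pos[OF z] by (simp add: zero_le_mult_iff)
  qed
  have qhol: "q holomorphic_on unit_disc"
    unfolding q_def using pos by (intro holomorphic_intros hol) auto
  have inf: "\<exists>w\<in>unit_disc. Re (q w) * (cmod (x - w))\<^sup>2 < e * (1 - (cmod w)\<^sup>2)" if "e > 0" for e
  proof -
    have "\<exists>w\<in>unit_disc. Q w < a + e"
      using that bdd cINF_less_iff[of unit_disc Q "a + e"] by (auto simp: a_def)
    then obtain w where w: "w \<in> unit_disc" "Q w - a < e" by auto
    show ?thesis using ReqQ[OF w(1)] w pos(1)[OF w(1)] by (intro bexI[of _ w]) auto
  qed
  have "((\<lambda>z. (x - z) * p z) \<longlongrightarrow> of_real (2 * a) * x) (at x within stolz_angle x R)" if R: "1 < R" for R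
  proof -
    have "((\<lambda>z. (x - z) * q z + of_real a * (x + z)) \<longlongrightarrow> 0 + of_real a * (x + x)) (at x within stolz_angle x R)"
      by (intro tendsto_intros angular_limit_half_plane_vanishing[OF qhol qnonneg x R inf])
    also have "0 + of_real a * (x + x) = of_real (2 * a) * x" by simp
    finally show ?thesis
    proof (rule Lim_transform_eventually)
      show "eventually (\<lambda>z. (x - z) * q z + of_real a * (x + z) = (x - z) * p z) (at x within stolz_angle x R)"
        using eventually_in_stolz_angle
      proof eventually_elim
        case (elim z)
        then have "x - z \<noteq> 0" using pos stolz_angle_subset_disc by blast
        then show ?case by (simp add: q_def field_simps)
      qed
    qed
  qed
  with a0 show ?thesis by blast
qed

text \<open>Since \<open>cmod x = 1\<close>, the factor
  \<open>(z - \<tau>) * (cnj \<tau> * z - 1)\<close> takes the value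
  \<open>- x * (cmod (x - \<tau>))\<^sup>2\<close> at \<open>x\<close>. Hence the limit of
  \<open>(x - z) * p z\<close>, a nonnegative multiple of \<open>x\<close>, fixes the argument of
  the limit for \<open>G\<close>.\<close>

lemma Berkson_Porta_angular_limit:
  assumes hol: "p holomorphic_on unit_disc"
    and nonneg: "\<And>z. z \<in> unit_disc \<Longrightarrow> 0 \<le> Re (p z)"
    and G: "\<And>z. z \<in> unit_disc \<Longrightarrow> G z = (z - \<tau>) * (cnj \<tau> * z - 1) * p z"
    and x: "cmod x = 1"
  shows "\<exists>c\<ge>0. \<forall>R>1. ((\<lambda>z. G z * (x - z)) \<longlongrightarrow> - of_real c * x\<^sup>2) (at x within stolz_angle x R)"
proof -
  obtain a where a: "a \<ge> 0"
    and lim: "\<And>R. 1 < R \<Longrightarrow> ((\<lambda>z. (x - z) * p z) \<longlongrightarrow> of_real (2 * a) * x) (at x within stolz_angle x R)"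
    using angular_limit_half_plane[OF hol nonneg x] by auto
  define c where "c = 2 * a * (cmod (x - \<tau>))\<^sup>2"
  have "x * cnj x = 1" using x complex_norm_square[of x] by simp
  then have *: "cnj \<tau> * x - 1 = - (x * cnj (x - \<tau>))" by (simp add: algebra_simps)
  have val: "(x - \<tau>) * (cnj \<tau> * x - 1) * (of_real (2 * a) * x) = - of_real c * x\<^sup>2"
  proof -
    have "(x - \<tau>) * (cnj \<tau> * x - 1) * (of_real (2 * a) * x) =
        - (of_real (2 * a) * ((x - \<tau>) * cnj (x - \<tau>))) * x\<^sup>2"
      unfolding * by (simp add: power2_eq_square mult_ac del: complex_cnj_diff)
    also have "(x - \<tau>) * cnj (x - \<tau>) = of_real ((cmod (x - \<tau>))\<^sup>2)"
      by (simp only: complex_norm_square)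
    finally show ?thesis by (simp add: c_def)
  qed
  have "((\<lambda>z. G z * (x - z)) \<longlongrightarrow> - of_real c * x\<^sup>2) (at x within stolz_angle x R)" if R: "1 < R" for R
  proof -
    have "((\<lambda>z. (z - \<tau>) * (cnj \<tau> * z - 1) * ((x - z) * p z)) \<longlongrightarrow>
        (x - \<tau>) * (cnj \<tau> * x - 1) * (of_real (2 * a) * x)) (at x within stolz_angle x R)"
      by (intro tendsto_intros lim R)
    then show ?thesis
      unfolding val
    proof (rule Lim_transform_eventually)
      show "eventually (\<lambda>z. (z - \<tau>) * (cnj \<tau> * z - 1) * ((x - z) * p z) = G z * (x - z))
          (at x within stolz_angle x R)"
        using eventually_in_stolz_angle
      proof eventually_elim
        case (elim z)
        then have "z \<in> unit_disc" using stolz_angle_subset_disc by blast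
        from G[OF this] show ?case by simp
      qed
    qed
  qed
  moreover have "c \<ge> 0" using a by (simp add: c_def)
  ultimately show ?thesis by blast
qed

section \<open>Regular poles and beta-points in terms of limits in Stolz angles\<close>

text \<open>The lower limit in every Stolz angle is a genuine limit, equal to \<open>c\<close>, so
  the infimum over the apertures is \<open>c\<close> as well.\<close>

lemma regular_pole_iff_angular_limit:
  assumes x: "cmod x = 1" and c: "c \<ge> 0"
    and lim: "\<And>R. 1 < R \<Longrightarrow> ((\<lambda>z. G z * (x - z)) \<longlongrightarrow> - of_real c * x\<^sup>2) (at x within stolz_angle x R)"
  shows "regular_pole G x \<longleftrightarrow> c > 0"
proof -
  have "Liminf (at x within stolz_angle x R) (\<lambda>z. ereal (cmod (G z * (x - z)))) = ereal c"
    if R: "R \<in> {1<..}" for R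
  proof -
    have "((\<lambda>z. cmod (G z * (x - z))) \<longlongrightarrow> cmod (- of_real c * x\<^sup>2)) (at x within stolz_angle x R)"
      using R by (intro tendsto_norm lim) auto
    moreover have "cmod (- of_real c * x\<^sup>2) = c" using x c by (simp add: norm_mult norm_power)
    ultimately show ?thesis
      using R at_within_stolz_angle_nontrivial[OF x]
      by (intro lim_imp_Liminf) auto
  qed
  then have "angular_liminf (\<lambda>z. cmod (G z * (x - z))) x = (INF R\<in>{1::real<..}. ereal c)"
    unfolding angular_liminf_def by (intro INF_cong) auto
  also have "\<dots> = ereal c"
    by (intro cINF_const) (auto intro: exI[of _ 2])
  finally show ?thesis
    by (auto simp: regular_pole_def regular_pole_of_mass_def)
qed

text \<open>One \<open>L\<close> has to serve all apertures, because finite limits depending on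
  \<open>R\<close> could have an infinite supremum.\<close>

lemma beta_pointI:
  assumes x: "cmod x = 1"
    and lim: "\<And>R. 1 < R \<Longrightarrow> ((\<lambda>z. cmod (deriv f z) / cmod (x - z)) \<longlongrightarrow> L) (at x within stolz_angle x R)"
  shows "beta_point f x"
proof -
  have "Limsup (at x within stolz_angle x R) (\<lambda>z. ereal (cmod (deriv f z) / cmod (x - z))) = ereal L"
    if R: "R \<in> {1<..}" for R
    using R lim[of R] at_within_stolz_angle_nontrivial[OF x]
    by (intro lim_imp_Limsup) auto
  then have "angular_limsup (\<lambda>z. cmod (deriv f z) / cmod (x - z)) x \<le> ereal L"
    unfolding angular_limsup_def by (intro SUP_least) auto
  also have "\<dots> < \<infinity>" by simp
  finally show ?thesis by (simp add: beta_point_def)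
qed

lemma beta_point_derivative_bound:
  assumes x: "cmod x = 1" and R: "1 < R" and \<beta>: "beta_point f x"
  obtains L where "L \<ge> 0" "eventually (\<lambda>z. cmod (deriv f z) \<le> L * cmod (x - z)) (at x within stolz_angle x R)"
proof -
  have "Limsup (at x within stolz_angle x R) (\<lambda>z. ereal (cmod (deriv f z) / cmod (x - z)))
      \<le> angular_limsup (\<lambda>z. cmod (deriv f z) / cmod (x - z)) x"
    unfolding angular_limsup_def using R by (intro SUP_upper) auto
  also have "\<dots> < \<infinity>" using \<beta> by (simp add: beta_point_def)
  finally obtain L0 :: real where
    "Limsup (at x within stolz_angle x R) (\<lambda>z. ereal (cmod (deriv f z) / cmod (x - z))) < ereal L0"
    using less_PInf_Ex_of_nat by auto
  then have "eventually (\<lambda>z. ereal (cmod (deriv f z) / cmod (x - z)) < ereal L0) (at x within stolz_angle x R)"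
    by (rule Limsup_lessD)
  then have "eventually (\<lambda>z. cmod (deriv f z) \<le> max L0 0 * cmod (x - z)) (at x within stolz_angle x R)"
    using eventually_in_stolz_angle
  proof eventually_elim
    case (elim z)
    then have "cmod (x - z) > 0" using not_in_stolz_angle[OF x] by auto
    then have "cmod (deriv f z) \<le> L0 * cmod (x - z)" using elim by (simp add: field_simps)
    also have "\<dots> \<le> max L0 0 * cmod (x - z)" by (intro mult_right_mono) auto
    finally show ?case .
  qed
  then show ?thesis by (intro that[of "max L0 0"]) auto
qed

section \<open>Primitives of \<open>1 / G\<close> near a pole\<close>

text \<open>Near \<open>x\<close> the modulus of \<open>G z * (x - z)\<close> exceeds
  \<open>cmod A / 2\<close>, so \<open>1 / G\<close> is holomorphic on a convex set and is
  \<open>O(x - z)\<close>; its primitive then has a limit by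
  \<open>angular_limit_of_small_derivative\<close>.\<close>

lemma local_primitive:
  assumes hol: "G holomorphic_on unit_disc" and x: "cmod x = 1" and R: "1 < R" and A: "A \<noteq> 0"
    and lim: "((\<lambda>z. G z * (x - z)) \<longlongrightarrow> A) (at x within stolz_angle x R)"
  obtains d f y where "d > 0"
    "\<And>z. z \<in> stolz_angle x R \<inter> ball x d \<Longrightarrow> G z \<noteq> 0"
    "\<And>z. z \<in> stolz_angle x R \<inter> ball x d \<Longrightarrow> (f has_field_derivative 1 / G z) (at z)"
    "(f \<longlongrightarrow> y) (at x within stolz_angle x R)"
proof -
  let ?S = "stolz_angle x R"
  have "((\<lambda>z. cmod (G z * (x - z))) \<longlongrightarrow> cmod A) (at x within ?S)"
    by (intro tendsto_norm lim)
  moreover have "cmod A / 2 < cmod A" using A by simp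
  ultimately have "eventually (\<lambda>z. cmod A / 2 < cmod (G z * (x - z))) (at x within ?S)"
    by (rule order_tendstoD)
  then obtain d where d: "d > 0"
    and big: "\<And>z. z \<in> ?S \<inter> ball x d \<Longrightarrow> cmod A / 2 < cmod (G z * (x - z))"
    unfolding eventually_at_stolz_angle[OF x] by auto
  have nz: "G z \<noteq> 0" if "z \<in> ?S \<inter> ball x d" for z using big[OF that] A by auto
  have "convex (?S \<inter> ball x d)" using R by (intro convex_Int convex_stolz_angle) auto
  moreover have op: "open (?S \<inter> ball x d)" by (intro open_Int open_stolz_angle) auto
  moreover have "(\<lambda>z. 1 / G z) holomorphic_on (?S \<inter> ball x d)"
    using nz stolz_angle_subset_disc by (intro holomorphic_intros holomorphic_on_subset[OF hol]) auto
  ultimately obtain f where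
    "\<And>z. z \<in> ?S \<inter> ball x d \<Longrightarrow> (f has_field_derivative 1 / G z) (at z within (?S \<inter> ball x d))"
    using holomorphic_convex_primitive' by blast
  then have f: "(f has_field_derivative 1 / G z) (at z)" if "z \<in> ?S \<inter> ball x d" for z
    using that op at_within_open by metis
  have "cmod (1 / G z) \<le> 2 / cmod A * cmod (x - z)" if "z \<in> ?S \<inter> ball x d" for z
    using big[OF that, unfolded norm_mult] nz[OF that] A by (simp add: norm_divide field_simps)
  then obtain y where "(f \<longlongrightarrow> y) (at x within ?S)"
    using angular_limit_of_small_derivative[OF x R d _ f, of "2 / cmod A"] by auto
  then show ?thesis using that[OF d nz f] by blast
qed

text \<open>Near \<open>x\<close> the function \<open>f - y\<close> behaves like \<open>(x - z)\<^sup>2 / (2 c x\<^sup>2)\<close>, which takes the values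
  \<open>\<plusminus> \<i> s\<^sup>2 / c\<close> at \<open>z = x (1 - s \<mp> \<i> s)\<close>; on the segment between these two points \<open>Im f\<close>
  therefore takes the value \<open>Im y\<close>.\<close>

lemma local_primitive_crosses:
  assumes x: "cmod x = 1" and c: "c > 0"
    and lim: "((\<lambda>z. G z * (x - z)) \<longlongrightarrow> - of_real c * x\<^sup>2) (at x within stolz_angle x 2)"
    and d: "d > 0"
    and nz: "\<And>z. z \<in> stolz_angle x 2 \<inter> ball x d \<Longrightarrow> G z \<noteq> 0"
    and f: "\<And>z. z \<in> stolz_angle x 2 \<inter> ball x d \<Longrightarrow> (f has_field_derivative 1 / G z) (at z)"
    and y: "(f \<longlongrightarrow> y) (at x within stolz_angle x 2)"
    and e: "e > 0"
  obtains z where "z \<in> stolz_angle x 2 \<inter> ball x d" "Im (f z) = Im y" "cmod (f z - y) < e"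
proof -
  let ?S = "stolz_angle x 2"
  have x0: "x \<noteq> 0" using x by auto
  define A where "A = - of_real c * x\<^sup>2"
  have A0: "A \<noteq> 0" using c x0 by (simp add: A_def)
  \<comment> \<open>\<open>F\<close> is \<open>f\<close> minus its quadratic model
    \<open>- (x - z)\<^sup>2 / (2 * A)\<close>; \<open>F'\<close> is its derivative.\<close>
  define F where "F z = f z + (x - z)\<^sup>2 / (2 * A)" for z
  define F' where "F' z = 1 / G z - (x - z) / A" for z
  have "((\<lambda>z. cmod (1 / (G z * (x - z)) - 1 / A)) \<longlongrightarrow> cmod (1 / A - 1 / A)) (at x within ?S)"
    using A0 lim by (intro tendsto_intros) (auto simp: A_def)
  \<comment> \<open>With this bound the deviation from the model is at most
    \<open>s\<^sup>2 / (2 * c)\<close> at the two endpoints, half of the main term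
    \<open>s\<^sup>2 / c\<close>.\<close>
  moreover have "cmod (1 / A - 1 / A) < 1 / (4 * c)" using c by simp
  ultimately have "eventually (\<lambda>z. cmod (1 / (G z * (x - z)) - 1 / A) < 1 / (4 * c)) (at x within ?S)"
    by (rule order_tendstoD)
  moreover have "eventually (\<lambda>z. cmod (f z - y) < e) (at x within ?S)"
    using tendstoD[OF y e] by (simp add: dist_norm)
  moreover have "eventually (\<lambda>z. z \<in> ball x d) (at x within ?S)"
    using d unfolding eventually_at_stolz_angle[OF x] by auto
  ultimately have "eventually (\<lambda>z. cmod (1 / (G z * (x - z)) - 1 / A) < 1 / (4 * c) \<and>
      cmod (f z - y) < e \<and> z \<in> ball x d) (at x within ?S)"
    by eventually_elim auto
  then obtain d' where d': "d' > 0"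
    and small: "\<And>z. z \<in> ?S \<inter> ball x d' \<Longrightarrow> cmod (1 / (G z * (x - z)) - 1 / A) < 1 / (4 * c)"
    and fe: "\<And>z. z \<in> ?S \<inter> ball x d' \<Longrightarrow> cmod (f z - y) < e"
    and zd: "\<And>z. z \<in> ?S \<inter> ball x d' \<Longrightarrow> z \<in> ball x d"
    unfolding eventually_at_stolz_angle[OF x] by auto
  have F: "(F has_field_derivative F' z) (at z)" if z: "z \<in> ?S \<inter> ball x d'" for z
  proof -
    have "z \<in> ?S \<inter> ball x d" using z zd by auto
    from f[OF this] show ?thesis
      unfolding F_def F'_def using A0 by (auto intro!: derivative_eq_intros simp: field_simps)
  qed
  have F': "cmod (F' z) \<le> 1 / (4 * c) * cmod (x - z)" if z: "z \<in> ?S \<inter> ball x d'" for z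
  proof -
    have "z \<in> ?S \<inter> ball x d" using z zd by auto
    then have "G z \<noteq> 0" "x - z \<noteq> 0" using nz not_in_stolz_angle[OF x] by auto
    then have "F' z = (1 / (G z * (x - z)) - 1 / A) * (x - z)"
      using A0 by (simp add: F'_def field_simps)
    then have "cmod (F' z) = cmod (1 / (G z * (x - z)) - 1 / A) * cmod (x - z)"
      by (simp only: norm_mult)
    also have "\<dots> \<le> 1 / (4 * c) * cmod (x - z)"
      using small[OF z] by (intro mult_right_mono) auto
    finally show ?thesis .
  qed
  have "0 \<le> 1 / (4 * c)" "1 < (2::real)" using c by simp_all
  from angular_limit_of_small_derivative[OF x this(2) d' this(1) F F'] obtain y' where
    lim_bd: "(F \<longlongrightarrow> y') (at x within ?S) \<and>
      (\<forall>z \<in> ?S \<inter> ball x d'. cmod (F z - y') \<le> 1 / (4 * c) * (cmod (x - z))\<^sup>2)" ..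
  note y' = conjunct1[OF lim_bd] and bd = bspec[OF conjunct2[OF lim_bd]]
  have "(F \<longlongrightarrow> y + (x - x)\<^sup>2 / (2 * A)) (at x within ?S)"
    unfolding F_def using A0 by (intro tendsto_intros y) auto
  then have [simp]: "y' = y"
    using tendsto_unique[OF at_within_stolz_angle_nontrivial[OF x, of 2] y'] by simp
  define s where "s = min (1/4) (d' / 4)"
  have s: "0 < s" "s \<le> 1/4" "s \<le> d' / 4" using d' by (auto simp: s_def)
  \<comment> \<open>Here \<open>u\<close> stands for \<open>1 + \<i>\<close> and
    \<open>1 - \<i>\<close>. Aperture 2 suffices: \<open>cmod (x - z)\<close> is at most
    \<open>3/2 * s\<close>, while \<open>1 - cmod z\<close> exceeds \<open>3/4 * s\<close> once
    \<open>s \<le> 1/4\<close>.\<close>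
  have pt: "x * (1 - of_real s * u) \<in> ?S \<inter> ball x d' \<and>
      (cmod (x - x * (1 - of_real s * u)))\<^sup>2 = 2 * s\<^sup>2 \<and>
      (x - x * (1 - of_real s * u))\<^sup>2 / (2 * A) = - (of_real s)\<^sup>2 * u\<^sup>2 / (2 * of_real c)"
    if u: "Re u = 1" "\<bar>Im u\<bar> = 1" for u
  proof -
    let ?z = "x * (1 - of_real s * u)"
    have xz: "x - ?z = x * (of_real s * u)" by (simp add: algebra_simps)
    have u2: "(cmod u)\<^sup>2 = 2"
      unfolding cmod_power2 using u by (metis one_add_one one_power2 power2_abs)
    have n2: "(cmod (x - ?z))\<^sup>2 = 2 * s\<^sup>2"
      unfolding xz norm_mult power_mult_distrib using x u2 by simp
    have "(cmod (x - ?z))\<^sup>2 \<le> (3/2 * s)\<^sup>2"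
      unfolding n2 power_mult_distrib by (intro mult_right_mono) (auto simp: power2_eq_square)
    then have n1: "cmod (x - ?z) \<le> 3/2 * s"
      by (rule power2_le_imp_le) (use s(1) in simp)
    have "(Im u)\<^sup>2 = 1" using u(2) by (metis one_power2 power2_abs)
    then have "(cmod (1 - of_real s * u))\<^sup>2 = 1 - 2 * s + 2 * s\<^sup>2"
      unfolding cmod_power2 using u(1) by (simp add: power2_eq_square algebra_simps)
    also have "\<dots> < (1 - 3/4 * s)\<^sup>2"
    proof -
      have "s * s \<le> 1/4 * s" using s by (intro mult_right_mono) auto
      then have "23 * (s * s) < 8 * s" using s(1) by linarith
      then show ?thesis by (simp add: power2_eq_square algebra_simps)
    qed
    finally have "cmod (1 - of_real s * u) < 1 - 3/4 * s"
      by (rule power2_less_imp_less) (use s(2) in simp)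
    then have z1: "cmod ?z < 1 - 3/4 * s" using x by (simp add: norm_mult)
    have "?z \<in> ?S" using z1 n1 s by (auto simp: stolz_angle_def)
    moreover have "?z \<in> ball x d'" using n1 s d' by (simp add: dist_norm)
    moreover have "(x - ?z)\<^sup>2 / (2 * A) = - (of_real s)\<^sup>2 * u\<^sup>2 / (2 * of_real c)"
      unfolding xz A_def using x0 c by (simp add: power_mult_distrib field_simps)
    ultimately show ?thesis using n2 by blast
  qed
  define z1 where "z1 = x * (1 - of_real s * (1 + \<i>))"
  define z2 where "z2 = x * (1 - of_real s * (1 - \<i>))"
  have pt1: "z1 \<in> ?S \<inter> ball x d'" "(cmod (x - z1))\<^sup>2 = 2 * s\<^sup>2"
    "(x - z1)\<^sup>2 / (2 * A) = - (of_real s)\<^sup>2 * (1 + \<i>)\<^sup>2 / (2 * of_real c)"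
    using pt[of "1 + \<i>"] by (auto simp: z1_def)
  have pt2: "z2 \<in> ?S \<inter> ball x d'" "(cmod (x - z2))\<^sup>2 = 2 * s\<^sup>2"
    "(x - z2)\<^sup>2 / (2 * A) = - (of_real s)\<^sup>2 * (1 - \<i>)\<^sup>2 / (2 * of_real c)"
    using pt[of "1 - \<i>"] by (auto simp: z2_def)
  have dev1: "\<bar>Im (F z1 - y)\<bar> \<le> s\<^sup>2 / (2 * c)"
    using bd[OF pt1(1)] abs_Im_le_cmod[of "F z1 - y"] unfolding pt1(2) by simp
  have dev2: "\<bar>Im (F z2 - y)\<bar> \<le> s\<^sup>2 / (2 * c)"
    using bd[OF pt2(1)] abs_Im_le_cmod[of "F z2 - y"] unfolding pt2(2) by simp
  have "(x - z1)\<^sup>2 / (2 * A) = of_real (- (s\<^sup>2 / c)) * \<i>"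
    unfolding pt1(3) by (simp add: power2_eq_square algebra_simps)
  then have "Im (F z1 - y) = Im (f z1) - Im y - s\<^sup>2 / c" by (simp add: F_def)
  moreover have "(x - z2)\<^sup>2 / (2 * A) = of_real (s\<^sup>2 / c) * \<i>"
    unfolding pt2(3) by (simp add: power2_eq_square algebra_simps)
  then have "Im (F z2 - y) = Im (f z2) - Im y + s\<^sup>2 / c" by (simp add: F_def)
  moreover have "s\<^sup>2 / (2 * c) < s\<^sup>2 / c" using s c by (simp add: field_simps)
  ultimately have sign: "Im (f z2) \<le> Im y" "Im y \<le> Im (f z1)"
    using dev1 dev2 by linarith+
  have seg: "closed_segment z2 z1 \<subseteq> ?S \<inter> ball x d'"
    using pt1(1) pt2(1) by (intro closed_segment_subset convex_Int convex_stolz_angle) auto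
  have "continuous_on (?S \<inter> ball x d) f"
    by (meson DERIV_isCont continuous_at_imp_continuous_on f)
  then have "continuous_on (closed_segment z2 z1) f"
    by (rule continuous_on_subset) (use seg zd in blast)
  then have "connected (f ` closed_segment z2 z1)"
    by (intro connected_continuous_image) auto
  \<comment> \<open>The inner product with \<open>\<i>\<close> is the imaginary part, so this is the
    intermediate value theorem for \<open>Im f\<close> on the segment.\<close>
  then obtain w where "w \<in> f ` closed_segment z2 z1" "Im w = Im y"
    using connected_ivt_component[of "f ` closed_segment z2 z1" "f z2" "f z1" \<i> "Im y"] sign
    by (auto simp: inner_complex_def)
  then obtain z where z: "z \<in> closed_segment z2 z1" "Im (f z) = Im y" by auto
  then have "z \<in> ?S \<inter> ball x d'" using seg by auto
  then show ?thesis using that[of z] z zd fe by auto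
qed

section \<open>Limits pulled back by injective maps, and angular limits of self-maps of the
  disc\<close>

text \<open>By the open mapping theorem \<open>h\<close> sends neighbourhoods of \<open>w\<close> to
  neighbourhoods of \<open>h w\<close>, and injectivity brings \<open>g z\<close> back into
  them.\<close>

lemma injective_holomorphic_tendsto_inverse:
  assumes hol: "h holomorphic_on S" and op: "open S" and inj: "inj_on h S" and w: "w \<in> S"
    and mem: "eventually (\<lambda>z. g z \<in> S) F" and lim: "((\<lambda>z. h (g z)) \<longlongrightarrow> h w) F"
  shows "(g \<longlongrightarrow> w) F"
proof (rule topological_tendstoI)
  fix U assume U: "open U" "w \<in> U"
  have "open (h ` (U \<inter> S))"
    using U op by (intro open_mapping_thm3 holomorphic_on_subset[OF hol] inj_on_subset[OF inj]) auto
  moreover have "h w \<in> h ` (U \<inter> S)" using U w by auto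
  ultimately have "eventually (\<lambda>z. h (g z) \<in> h ` (U \<inter> S)) F"
    using topological_tendstoD[OF lim] by blast
  with mem show "eventually (\<lambda>z. g z \<in> U) F"
    by eventually_elim (use inj in \<open>auto dest: inj_onD\<close>)
qed

text \<open>A boundary value \<open>y\<close> would be approached at a quadratic rate, so that \<open>(y + f) / (y - f)\<close>,
  whose real part is positive, would grow faster than \<open>angular_limit_half_plane\<close> allows.\<close>

lemma self_map_interior_angular_limit:
  assumes hol: "f holomorphic_on unit_disc" and self: "f ` unit_disc \<subseteq> unit_disc"
    and x: "cmod x = 1" and R: "1 < R" and L: "L \<ge> 0"
    and der: "eventually (\<lambda>z. cmod (deriv f z) \<le> L * cmod (x - z)) (at x within stolz_angle x R)"
  obtains y where "y \<in> unit_disc" "(f \<longlongrightarrow> y) (at x within stolz_angle x R)"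
proof -
  let ?S = "stolz_angle x R" and ?F = "at x within stolz_angle x R"
  have nontriv: "?F \<noteq> bot" by (rule at_within_stolz_angle_nontrivial[OF x R])
  obtain d where d: "d > 0"
    and der: "\<And>z. z \<in> ?S \<inter> ball x d \<Longrightarrow> cmod (deriv f z) \<le> L * cmod (x - z)"
    using der unfolding eventually_at_stolz_angle[OF x] by auto
  have "(f has_field_derivative deriv f z) (at z)" if "z \<in> ?S \<inter> ball x d" for z
    using that stolz_angle_subset_disc[of x R] by (intro holomorphic_derivI[OF hol]) auto
  from angular_limit_of_small_derivative[OF x R d L this der] obtain y where
    y: "(f \<longlongrightarrow> y) ?F"
    and bd: "\<And>z. z \<in> ?S \<inter> ball x d \<Longrightarrow> cmod (f z - y) \<le> L * (cmod (x - z))\<^sup>2"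
    by auto
  have f1: "cmod (f z) < 1" if "z \<in> unit_disc" for z
    using self that by (auto simp: image_subset_iff)
  have "cmod y \<le> 1"
  proof (rule tendsto_upperbound[OF tendsto_norm[OF y] _ nontriv])
    show "eventually (\<lambda>z. cmod (f z) \<le> 1) ?F"
      using eventually_in_stolz_angle
      by eventually_elim (rule less_imp_le[OF f1], rule subsetD[OF stolz_angle_subset_disc])
  qed
  moreover have "cmod y \<noteq> 1"
  proof
    assume y1: "cmod y = 1"
    define p where "p z = (y + f z) / (y - f z)" for z
    have ynz: "y - f z \<noteq> 0" if "z \<in> unit_disc" for z
      using f1[OF that] y1 by auto
    have phol: "p holomorphic_on unit_disc"
      unfolding p_def using ynz by (intro holomorphic_intros hol) auto
    have ppos: "0 \<le> Re (p z)" if "z \<in> unit_disc" for z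
      unfolding p_def Re_Poisson_kernel[OF y1] using f1[OF that]
      by (simp add: abs_square_le_1)
    obtain a where plim: "((\<lambda>z. (x - z) * p z) \<longlongrightarrow> of_real (2 * a) * x) ?F"
      using angular_limit_half_plane[OF phol ppos x] R by blast
    \<comment> \<open>This product tends to 0, yet it bounds \<open>cmod (y + f z)\<close>, which
      tends to 2.\<close>
    have "((\<lambda>z. cmod ((x - z) * p z) * (L * cmod (x - z))) \<longlongrightarrow>
        cmod (of_real (2 * a) * x) * (L * cmod (x - x))) ?F"
      by (intro plim tendsto_intros)
    moreover have "((\<lambda>z. cmod (y + f z)) \<longlongrightarrow> cmod (y + y)) ?F"
      by (intro tendsto_intros y)
    moreover have "eventually (\<lambda>z. cmod (y + f z) \<le> cmod ((x - z) * p z) * (L * cmod (x - z))) ?F"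
      unfolding eventually_at_stolz_angle[OF x]
    proof (intro exI conjI ballI)
      show "d > 0" by (rule d)
      fix z assume z: "z \<in> ?S \<inter> ball x d"
      then have zd: "z \<in> unit_disc" using stolz_angle_subset_disc by blast
      have "cmod (y + f z) = cmod (p z) * cmod (f z - y)"
        using ynz[OF zd] by (simp add: p_def norm_divide norm_minus_commute)
      also have "\<dots> \<le> cmod (p z) * (L * (cmod (x - z))\<^sup>2)"
        by (intro mult_left_mono bd z) auto
      finally show "cmod (y + f z) \<le> cmod ((x - z) * p z) * (L * cmod (x - z))"
        by (simp add: norm_mult power2_eq_square mult_ac)
    qed
    ultimately have "cmod (y + y) \<le> cmod (of_real (2 * a) * x) * (L * cmod (x - x))"
      using nontriv by (intro tendsto_le)
    then show False using y1 by (simp flip: mult_2 add: norm_mult)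
  qed
  ultimately show ?thesis using y by (intro that[of y]) auto
qed

section \<open>The linearised flow\<close>

text \<open>Both normalisations of the Koenigs function are instances of \<open>h' G = l h + b\<close>, with
  \<open>l = G' \<tau>\<close>, \<open>b = 0\<close> for an interior and \<open>l = 0\<close>, \<open>b = 1\<close> for a boundary point \<open>\<tau>\<close>.\<close>

locale koenigs_model =
  fixes \<phi> :: "real \<Rightarrow> complex \<Rightarrow> complex" and G h :: "complex \<Rightarrow> complex"
    and l b x :: complex and c :: real
  assumes semigroup: "holomorphic_semigroup \<phi>"
    and generator: "generator_of \<phi> G"
    and h_holomorphic: "h holomorphic_on unit_disc"
    and h_inj: "inj_on h unit_disc"
    and h_ode: "z \<in> unit_disc \<Longrightarrow> deriv h z * G z = l * h z + b"
    and l_or_b: "l = 0 \<or> b = 0"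
    and x_norm: "cmod x = 1"
    and c_nonneg: "0 \<le> c"
    and G_angular: "1 < R \<Longrightarrow> ((\<lambda>z. G z * (x - z)) \<longlongrightarrow> - of_real c * x\<^sup>2) (at x within stolz_angle x R)"
begin

lemma G_holomorphic: "G holomorphic_on unit_disc"
  using generator by (simp add: generator_of_def)

lemma semigroup_holomorphic: "0 \<le> t \<Longrightarrow> \<phi> t holomorphic_on unit_disc"
  using semigroup by (simp add: holomorphic_semigroup_def)

lemma semigroup_self_map: "0 \<le> t \<Longrightarrow> \<phi> t ` unit_disc \<subseteq> unit_disc"
  using semigroup by (simp add: holomorphic_semigroup_def)

lemma semigroup_in_disc: "0 \<le> t \<Longrightarrow> z \<in> unit_disc \<Longrightarrow> \<phi> t z \<in> unit_disc"
  using semigroup_self_map by blast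

lemma deriv_h_nonzero: "z \<in> unit_disc \<Longrightarrow> deriv h z \<noteq> 0"
  using holomorphic_injective_imp_regular[OF h_holomorphic _ h_inj] by simp

text \<open>Along an orbit \<open>h\<close> solves the linear equation \<open>u' = l u + b\<close>.
  The integrating factor \<open>exp (- s l)\<close> leaves \<open>b\<close> unchanged because
  \<open>l\<close> or \<open>b\<close> vanishes, so the quantity \<open>k\<close> below is
  conserved.\<close>

lemma h_semigroup:
  assumes t: "0 \<le> t" and z: "z \<in> unit_disc"
  shows "h (\<phi> t z) = exp (of_real t * l) * h z + of_real t * b"
proof -
  define k where "k s = exp (s *\<^sub>R (- l)) * h (\<phi> s z) - s *\<^sub>R b" for s
  have der: "(k has_vector_derivative 0) (at s within {0..})" if s: "s \<in> {0..}" for s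
  proof -
    let ?w = "\<phi> s z"
    have w: "?w \<in> unit_disc" using s z by (intro semigroup_in_disc) auto
    have "((\<lambda>s. \<phi> s z) has_vector_derivative G ?w) (at s within {0..})"
      using generator s z by (simp add: generator_of_def)
    moreover have "(h has_field_derivative deriv h ?w) (at ?w within (\<lambda>s. \<phi> s z) ` {0..})"
      using w by (intro holomorphic_derivI[OF h_holomorphic] has_field_derivative_at_within) auto
    ultimately have "(h \<circ> (\<lambda>s. \<phi> s z) has_vector_derivative G ?w * deriv h ?w) (at s within {0..})"
      by (rule field_vector_diff_chain_within)
    then have 1: "((\<lambda>s. h (\<phi> s z)) has_vector_derivative l * h ?w + b) (at s within {0..})"
      using h_ode[OF w] by (simp add: o_def mult.commute)
    have 2: "((\<lambda>s. exp (s *\<^sub>R (- l))) has_vector_derivative exp (s *\<^sub>R (- l)) * (- l)) (at s within {0..})"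
      by (rule exp_scaleR_has_vector_derivative_right)
    have 3: "((\<lambda>s. s *\<^sub>R b) has_vector_derivative b) (at s within {0..})"
      unfolding has_vector_derivative_def
      by (rule bounded_linear_imp_has_derivative[OF bounded_linear_scaleR_left])
    have "(k has_vector_derivative (exp (s *\<^sub>R (- l)) * (l * h ?w + b) + exp (s *\<^sub>R (- l)) * (- l) * h ?w - b))
        (at s within {0..})"
      unfolding k_def by (intro has_vector_derivative_diff has_vector_derivative_mult 1 2 3)
    moreover have "exp (s *\<^sub>R (- l)) * (l * h ?w + b) + exp (s *\<^sub>R (- l)) * (- l) * h ?w - b = 0"
      using l_or_b by (auto simp: algebra_simps)
    ultimately show ?thesis by simp
  qed
  obtain K where K: "\<And>s. s \<in> {0..} \<Longrightarrow> k s = K"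
    using has_vector_derivative_zero_constant[of "{0::real..}" k] der by auto
  have "k t = k 0" using K[of t] K[of 0] t by simp
  moreover have "\<phi> 0 z = z" using semigroup z by (simp add: holomorphic_semigroup_def)
  ultimately have "exp (of_real t * - l) * h (\<phi> t z) = h z + of_real t * b"
    by (simp add: k_def scaleR_conv_of_real algebra_simps)
  then have "exp (of_real t * l) * (exp (of_real t * - l) * h (\<phi> t z)) =
      exp (of_real t * l) * (h z + of_real t * b)" by simp
  moreover have "exp (of_real t * l) * exp (of_real t * - l) = 1"
    by (simp flip: exp_add)
  ultimately have "h (\<phi> t z) = exp (of_real t * l) * (h z + of_real t * b)"
    by (metis mult.assoc mult_1)
  then show ?thesis using l_or_b by (auto simp: algebra_simps)
qed

lemma deriv_h_semigroup:
  assumes t: "0 \<le> t" and z: "z \<in> unit_disc"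
  shows "deriv h (\<phi> t z) * deriv (\<phi> t) z = exp (of_real t * l) * deriv h z"
proof -
  have "(h has_field_derivative deriv h (\<phi> t z)) (at (\<phi> t z))"
    using semigroup_in_disc[OF t z] by (intro holomorphic_derivI[OF h_holomorphic]) auto
  moreover have "(\<phi> t has_field_derivative deriv (\<phi> t) z) (at z)"
    using z by (intro holomorphic_derivI[OF semigroup_holomorphic[OF t]]) auto
  ultimately have 1: "((\<lambda>z. h (\<phi> t z)) has_field_derivative deriv h (\<phi> t z) * deriv (\<phi> t) z) (at z)"
    by (rule DERIV_chain2)
  have "(h has_field_derivative deriv h z) (at z)"
    using z by (intro holomorphic_derivI[OF h_holomorphic]) auto
  then have "((\<lambda>z. exp (of_real t * l) * h z + of_real t * b) has_field_derivative
      exp (of_real t * l) * deriv h z) (at z)"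
    by (auto intro!: derivative_eq_intros)
  then have "((\<lambda>z. h (\<phi> t z)) has_field_derivative exp (of_real t * l) * deriv h z) (at z)"
    by (rule has_field_derivative_transform_within_open[of _ _ _ unit_disc])
       (use z h_semigroup[OF t] in auto)
  with 1 show ?thesis by (rule DERIV_unique)
qed

text \<open>The primitive \<open>f\<close> acts as a complex time of the flow: in this coordinate
  \<open>h\<close> solves the same linear equation as along orbits.\<close>

lemma h_via_primitive:
  assumes W: "convex W" "W \<subseteq> unit_disc"
    and nz: "\<And>z. z \<in> W \<Longrightarrow> G z \<noteq> 0"
    and f: "\<And>z. z \<in> W \<Longrightarrow> (f has_field_derivative 1 / G z) (at z)"
  shows "\<exists>K. \<forall>z\<in>W. h z = exp (l * f z) * (K + b * f z)"
proof -
  define k where "k z = exp (- (l * f z)) * h z - b * f z" for z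
  have "(k has_field_derivative 0) (at z within W)" if z: "z \<in> W" for z
  proof -
    have zd: "z \<in> unit_disc" using z W by auto
    have hz: "deriv h z = (l * h z + b) / G z"
      using h_ode[OF zd] nz[OF z] by (simp add: field_simps)
    have "(h has_field_derivative (l * h z + b) / G z) (at z)"
      unfolding hz[symmetric] using zd by (intro holomorphic_derivI[OF h_holomorphic]) auto
    then have "(k has_field_derivative (exp (- (l * f z)) * ((l * h z + b) / G z)
        + exp (- (l * f z)) * (- (l * (1 / G z))) * h z - b * (1 / G z))) (at z)"
      unfolding k_def using f[OF z] by (auto intro!: derivative_eq_intros)
    moreover have "exp (- (l * f z)) * ((l * h z + b) / G z)
        + exp (- (l * f z)) * (- (l * (1 / G z))) * h z - b * (1 / G z) = 0"
      using l_or_b nz[OF z] by (auto simp: field_simps)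
    ultimately show ?thesis by (simp add: has_field_derivative_at_within)
  qed
  then obtain K where K: "\<And>z. z \<in> W \<Longrightarrow> k z = K"
    using has_field_derivative_zero_constant[OF W(1)] by blast
  have "h z = exp (l * f z) * (K + b * f z)" if z: "z \<in> W" for z
  proof -
    have "exp (- (l * f z)) * h z = K + b * f z" using K[OF z] by (simp add: k_def algebra_simps)
    then show ?thesis by (simp add: exp_minus field_simps)
  qed
  then show ?thesis by blast
qed

text \<open>The second property says that the linear flow carries the boundary value
  \<open>y\<close> into the image of \<open>h\<close> after any positive time, although
  \<open>y\<close> itself is only a limit.\<close>

lemma koenigs_boundary_value:
  assumes c: "c > 0"
  obtains y where "\<And>R. 1 < R \<Longrightarrow> (h \<longlongrightarrow> y) (at x within stolz_angle x R)"
    "\<And>t. 0 < t \<Longrightarrow> \<exists>w\<in>unit_disc. h w = exp (of_real t * l) * y + of_real t * b"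
proof -
  have one_less_two: "1 < (2::real)" by simp
  have A: "- of_real c * x\<^sup>2 \<noteq> 0" using c x_norm by auto
  have loc: "\<exists>d f f0 K. d > 0 \<and> (\<forall>z \<in> stolz_angle x R \<inter> ball x d. G z \<noteq> 0) \<and>
      (\<forall>z \<in> stolz_angle x R \<inter> ball x d. (f has_field_derivative 1 / G z) (at z)) \<and>
      (f \<longlongrightarrow> f0) (at x within stolz_angle x R) \<and>
      (\<forall>z \<in> stolz_angle x R \<inter> ball x d. h z = exp (l * f z) * (K + b * f z)) \<and>
      (h \<longlongrightarrow> exp (l * f0) * (K + b * f0)) (at x within stolz_angle x R)"
    if R: "1 < R" for R
  proof -
    obtain d f f0 where d: "d > 0"
      and nz: "\<And>z. z \<in> stolz_angle x R \<inter> ball x d \<Longrightarrow> G z \<noteq> 0"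
      and f: "\<And>z. z \<in> stolz_angle x R \<inter> ball x d \<Longrightarrow> (f has_field_derivative 1 / G z) (at z)"
      and f0: "(f \<longlongrightarrow> f0) (at x within stolz_angle x R)"
      using local_primitive[OF G_holomorphic x_norm R A G_angular[OF R]] by blast
    have "convex (stolz_angle x R \<inter> ball x d)"
      using R by (intro convex_Int convex_stolz_angle) auto
    moreover have "stolz_angle x R \<inter> ball x d \<subseteq> unit_disc"
      using stolz_angle_subset_disc by blast
    ultimately obtain K where
      K: "\<And>z. z \<in> stolz_angle x R \<inter> ball x d \<Longrightarrow> h z = exp (l * f z) * (K + b * f z)"
      using h_via_primitive[OF _ _ nz f] by blast
    have "((\<lambda>z. exp (l * f z) * (K + b * f z)) \<longlongrightarrow> exp (l * f0) * (K + b * f0))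
        (at x within stolz_angle x R)"
      by (intro tendsto_intros f0)
    moreover have "eventually (\<lambda>z. exp (l * f z) * (K + b * f z) = h z) (at x within stolz_angle x R)"
      unfolding eventually_at_stolz_angle[OF x_norm] using d K by auto
    ultimately have "(h \<longlongrightarrow> exp (l * f0) * (K + b * f0)) (at x within stolz_angle x R)"
      by (rule Lim_transform_eventually)
    with d nz f f0 K show ?thesis by blast
  qed
  have "\<exists>y. (h \<longlongrightarrow> y) (at x within stolz_angle x R)" if "1 < R" for R
    using loc[OF that] by blast
  from angular_tendsto_ex_common[OF x_norm this]
  obtain y where y: "\<And>R. 1 < R \<Longrightarrow> (h \<longlongrightarrow> y) (at x within stolz_angle x R)" by blast
  obtain d f f0 K where d: "d > 0"
    and nz: "\<And>z. z \<in> stolz_angle x 2 \<inter> ball x d \<Longrightarrow> G z \<noteq> 0"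
    and f: "\<And>z. z \<in> stolz_angle x 2 \<inter> ball x d \<Longrightarrow> (f has_field_derivative 1 / G z) (at z)"
    and f0: "(f \<longlongrightarrow> f0) (at x within stolz_angle x 2)"
    and K: "\<And>z. z \<in> stolz_angle x 2 \<inter> ball x d \<Longrightarrow> h z = exp (l * f z) * (K + b * f z)"
    and h0: "(h \<longlongrightarrow> exp (l * f0) * (K + b * f0)) (at x within stolz_angle x 2)"
    using loc[OF one_less_two] by blast
  have yeq: "y = exp (l * f0) * (K + b * f0)"
    using tendsto_unique[OF at_within_stolz_angle_nontrivial[OF x_norm, of 2] y h0] by simp
  have "\<exists>w\<in>unit_disc. h w = exp (of_real t * l) * y + of_real t * b" if t: "0 < t" for t
  proof -
    obtain z where z: "z \<in> stolz_angle x 2 \<inter> ball x d" "Im (f z) = Im f0" "cmod (f z - f0) < t"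
      using local_primitive_crosses[OF x_norm c G_angular[OF one_less_two] d nz f f0 t] by blast
    \<comment> \<open>The point \<open>z\<close> has real time offset \<open>s\<close> from the
      boundary value, with \<open>\<bar>s\<bar> < t\<close>; flowing from \<open>z\<close> for the
      remaining time \<open>t - s\<close> therefore ends where \<open>y\<close> would be after time
      \<open>t\<close>.\<close>
    define s where "s = Re (f z) - Re f0"
    have fz: "f z = f0 + of_real s" using z(2) by (simp add: s_def complex_eq_iff)
    have st: "0 \<le> t - s" using z(3) fz by simp
    have zd: "z \<in> unit_disc" using z stolz_angle_subset_disc by blast
    have "h (\<phi> (t - s) z) = exp (of_real (t - s) * l) * h z + of_real (t - s) * b"
      by (rule h_semigroup[OF st zd])
    also have "\<dots> = exp (of_real t * l) * y + of_real t * b"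
    proof (cases "l = 0")
      case True
      then show ?thesis unfolding K[OF z(1)] yeq fz by (simp add: algebra_simps)
    next
      case False
      then have "b = 0" using l_or_b by simp
      then show ?thesis unfolding K[OF z(1)] yeq fz
        by (simp add: algebra_simps flip: mult.assoc exp_add)
    qed
    finally show ?thesis using semigroup_in_disc[OF st zd] by blast
  qed
  with y show ?thesis using that by blast
qed

text \<open>Dividing \<open>h' G = l h + b\<close> by \<open>G z * (x - z)\<close> reduces the
  quotient to known limits; \<open>c > 0\<close> keeps the denominator away from 0.\<close>

lemma koenigs_quotient_limit:
  assumes c: "c > 0" and R: "1 < R" and y: "(h \<longlongrightarrow> y) (at x within stolz_angle x R)"
  shows "((\<lambda>z. cmod (deriv h z) / cmod (x - z)) \<longlongrightarrow> cmod (l * y + b) / c) (at x within stolz_angle x R)"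
proof -
  have A: "cmod (- of_real c * x\<^sup>2) = c" using c x_norm by (simp add: norm_mult norm_power)
  have "((\<lambda>z. cmod (l * h z + b) / cmod (G z * (x - z))) \<longlongrightarrow>
      cmod (l * y + b) / cmod (- of_real c * x\<^sup>2)) (at x within stolz_angle x R)"
    using A c by (intro tendsto_intros y G_angular[OF R]) auto
  then show ?thesis
    unfolding A
  proof (rule Lim_transform_eventually)
    have "eventually (\<lambda>z. 0 < cmod (G z * (x - z))) (at x within stolz_angle x R)"
      using A c by (intro order_tendstoD(1)[OF tendsto_norm[OF G_angular[OF R]]]) auto
    with eventually_in_stolz_angle
    show "eventually (\<lambda>z. cmod (l * h z + b) / cmod (G z * (x - z)) = cmod (deriv h z) / cmod (x - z))
        (at x within stolz_angle x R)"
    proof eventually_elim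
      case (elim z)
      then have "z \<in> unit_disc" using stolz_angle_subset_disc by blast
      from h_ode[OF this] have "cmod (l * h z + b) = cmod (deriv h z) * cmod (G z)"
        by (metis norm_mult)
      moreover have "G z \<noteq> 0" using elim by auto
      ultimately show ?case by (simp add: norm_mult)
    qed
  qed
qed

lemma beta_point_koenigs:
  assumes "c > 0"
  shows "beta_point h x"
  by (rule koenigs_boundary_value[OF assms])
     (blast intro: beta_pointI[OF x_norm] koenigs_quotient_limit[OF assms])

text \<open>\<open>\<phi> t\<close> tends to the interior point \<open>w\<close> with
  \<open>h w\<close> equal to the value of the linear flow at \<open>y\<close>. As
  \<open>deriv h w\<close> is nonzero, \<open>deriv_h_semigroup\<close> transfers the limit of the
  quotient from \<open>h\<close> to \<open>\<phi> t\<close>.\<close>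

lemma beta_point_semigroup:
  assumes c: "c > 0" and t: "0 < t"
  shows "beta_point (\<phi> t) x"
proof -
  obtain y where y: "\<And>R. 1 < R \<Longrightarrow> (h \<longlongrightarrow> y) (at x within stolz_angle x R)"
    and ex: "\<And>t. 0 < t \<Longrightarrow> \<exists>w\<in>unit_disc. h w = exp (of_real t * l) * y + of_real t * b"
    using koenigs_boundary_value[OF c] by blast
  obtain w where w: "w \<in> unit_disc" "h w = exp (of_real t * l) * y + of_real t * b"
    using ex[OF t] by blast
  have t0: "0 \<le> t" using t by simp
  have cont: "isCont (deriv h) w"
    using w(1) holomorphic_on_imp_continuous_on[OF holomorphic_deriv[OF h_holomorphic open_ball]]
    by (simp add: continuous_on_eq_continuous_at)
  show ?thesis
  proof (rule beta_pointI[OF x_norm])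
    fix R :: real assume R: "1 < R"
    let ?F = "at x within stolz_angle x R"
    have in_disc: "eventually (\<lambda>z. z \<in> unit_disc) ?F"
      by (rule eventually_mono[OF eventually_in_stolz_angle]) (rule subsetD[OF stolz_angle_subset_disc])
    have "((\<lambda>z. exp (of_real t * l) * h z + of_real t * b) \<longlongrightarrow> h w) ?F"
      unfolding w(2) by (intro tendsto_intros y R)
    moreover have "eventually (\<lambda>z. exp (of_real t * l) * h z + of_real t * b = h (\<phi> t z)) ?F"
      using in_disc by eventually_elim (rule h_semigroup[OF t0, symmetric])
    ultimately have "((\<lambda>z. h (\<phi> t z)) \<longlongrightarrow> h w) ?F"
      by (rule Lim_transform_eventually)
    moreover have "eventually (\<lambda>z. \<phi> t z \<in> unit_disc) ?F"
      using in_disc by eventually_elim (rule semigroup_in_disc[OF t0])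
    ultimately have "(\<phi> t \<longlongrightarrow> w) ?F"
      by (intro injective_holomorphic_tendsto_inverse[OF h_holomorphic open_ball h_inj w(1)])
    then have "((\<lambda>z. deriv h (\<phi> t z)) \<longlongrightarrow> deriv h w) ?F"
      by (rule isCont_tendsto_compose[OF cont])
    then have "((\<lambda>z. cmod (exp (of_real t * l)) / cmod (deriv h (\<phi> t z)) * (cmod (deriv h z) / cmod (x - z))) \<longlongrightarrow>
        cmod (exp (of_real t * l)) / cmod (deriv h w) * (cmod (l * y + b) / c)) ?F"
      using deriv_h_nonzero[OF w(1)] by (intro tendsto_intros koenigs_quotient_limit c R y) auto
    then show "((\<lambda>z. cmod (deriv (\<phi> t) z) / cmod (x - z)) \<longlongrightarrow>
        cmod (exp (of_real t * l)) / cmod (deriv h w) * (cmod (l * y + b) / c)) ?F"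
    proof (rule Lim_transform_eventually)
      show "eventually (\<lambda>z. cmod (exp (of_real t * l)) / cmod (deriv h (\<phi> t z)) * (cmod (deriv h z) / cmod (x - z))
          = cmod (deriv (\<phi> t) z) / cmod (x - z)) ?F"
        using in_disc
      proof eventually_elim
        case (elim z)
        have nz: "deriv h (\<phi> t z) \<noteq> 0" by (intro deriv_h_nonzero semigroup_in_disc t0 elim)
        have "cmod (deriv h (\<phi> t z)) * cmod (deriv (\<phi> t) z) = cmod (exp (of_real t * l)) * cmod (deriv h z)"
          using deriv_h_semigroup[OF t0 elim] by (metis norm_mult)
        then have "cmod (deriv (\<phi> t) z) = cmod (exp (of_real t * l)) * cmod (deriv h z) / cmod (deriv h (\<phi> t z))"
          using nz by (simp add: field_simps)
        then show ?case by simp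
      qed
    qed
  qed
qed

text \<open>If \<open>c\<close> were 0, then \<open>l h + b\<close>, which equals
  \<open>h' G\<close>, would be bounded by \<open>L * cmod (G z * (x - z))\<close> and tend to 0,
  against the lower bound \<open>m\<close>.\<close>

lemma pole_if_koenigs_derivative_small:
  assumes R: "1 < R" and m: "m > 0"
    and low: "eventually (\<lambda>z. m \<le> cmod (l * h z + b)) (at x within stolz_angle x R)"
    and der: "eventually (\<lambda>z. cmod (deriv h z) \<le> L * cmod (x - z)) (at x within stolz_angle x R)"
  shows "c > 0"
proof (rule ccontr)
  assume "\<not> c > 0"
  then have "c = 0" using c_nonneg by simp
  then have "((\<lambda>z. L * cmod (G z * (x - z))) \<longlongrightarrow> L * cmod (0::complex)) (at x within stolz_angle x R)"
    using G_angular[OF R] by (intro tendsto_intros) simp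
  moreover have "eventually (\<lambda>z. m \<le> L * cmod (G z * (x - z))) (at x within stolz_angle x R)"
    using low der eventually_in_stolz_angle
  proof eventually_elim
    case (elim z)
    then have "z \<in> unit_disc" using stolz_angle_subset_disc by blast
    from h_ode[OF this] have "cmod (l * h z + b) = cmod (deriv h z) * cmod (G z)"
      by (metis norm_mult)
    also have "\<dots> \<le> L * cmod (x - z) * cmod (G z)" using elim by (intro mult_right_mono) auto
    finally show ?case using elim by (simp add: norm_mult mult_ac)
  qed
  ultimately have "m \<le> L * cmod (0::complex)"
    using at_within_stolz_angle_nontrivial[OF x_norm R] tendsto_lowerbound by blast
  then show False using m by simp
qed

text \<open>The angular limit of \<open>\<phi> t\<close> lies inside the disc, so
  \<open>deriv h (\<phi> t z)\<close> stays bounded near \<open>x\<close> and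
  \<open>deriv_h_semigroup\<close> can be solved for \<open>deriv h z\<close>.\<close>

lemma koenigs_derivative_small_if_semigroup_derivative_small:
  assumes R: "1 < R" and t: "0 \<le> t" and L: "0 \<le> L"
    and der: "eventually (\<lambda>z. cmod (deriv (\<phi> t) z) \<le> L * cmod (x - z)) (at x within stolz_angle x R)"
  obtains L' where "eventually (\<lambda>z. cmod (deriv h z) \<le> L' * cmod (x - z)) (at x within stolz_angle x R)"
proof -
  let ?F = "at x within stolz_angle x R" and ?E = "cmod (exp (of_real t * l))"
  obtain y where y: "y \<in> unit_disc" "(\<phi> t \<longlongrightarrow> y) ?F"
    using self_map_interior_angular_limit[OF semigroup_holomorphic[OF t] semigroup_self_map[OF t] x_norm R L der]
    by blast
  have "isCont (deriv h) y"
    using y(1) holomorphic_on_imp_continuous_on[OF holomorphic_deriv[OF h_holomorphic open_ball]]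
    by (simp add: continuous_on_eq_continuous_at)
  then have "((\<lambda>z. cmod (deriv h (\<phi> t z))) \<longlongrightarrow> cmod (deriv h y)) ?F"
    by (intro tendsto_norm) (rule isCont_tendsto_compose[OF _ y(2)])
  then have "eventually (\<lambda>z. cmod (deriv h (\<phi> t z)) < cmod (deriv h y) + 1) ?F"
    by (rule order_tendstoD) simp
  then have "eventually (\<lambda>z. cmod (deriv h z) \<le> (cmod (deriv h y) + 1) * L / ?E * cmod (x - z)) ?F"
    using der eventually_in_stolz_angle
  proof eventually_elim
    case (elim z)
    then have "z \<in> unit_disc" using stolz_angle_subset_disc by blast
    from deriv_h_semigroup[OF t this]
    have "?E * cmod (deriv h z) = cmod (deriv h (\<phi> t z)) * cmod (deriv (\<phi> t) z)"
      by (metis norm_mult)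
    also have "\<dots> \<le> (cmod (deriv h y) + 1) * (L * cmod (x - z))"
      using elim by (intro mult_mono) auto
    finally show ?case by (simp add: field_simps)
  qed
  then show ?thesis by (rule that)
qed

end

section \<open>Lower bound near the circle and the equivalences\<close>

text \<open>Values near 0 are already taken near the zero \<open>\<tau>\<close>, so by injectivity
  they are not taken near the circle.\<close>

lemma injective_holomorphic_bounded_away_from_zero:
  assumes hol: "h holomorphic_on unit_disc" and inj: "inj_on h unit_disc"
    and \<tau>: "\<tau> \<in> unit_disc" "h \<tau> = 0" and x: "cmod x = 1"
  obtains m where "m > 0" "eventually (\<lambda>z. m \<le> cmod (h z)) (at x within stolz_angle x R)"
proof -
  \<comment> \<open>Half the distance from \<open>\<tau>\<close> to the circle, so that the ball
    around \<open>\<tau>\<close> stays below modulus \<open>1 - r\<close>.\<close>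
  define r where "r = (1 - cmod \<tau>) / 2"
  have r: "r > 0" using \<tau>(1) by (simp add: r_def)
  have sub: "cmod z < 1 - r" if "z \<in> ball \<tau> r" for z
  proof -
    have "cmod z \<le> cmod (\<tau> - z) + cmod \<tau>"
      using norm_triangle_ineq4[of \<tau> "\<tau> - z"] by simp
    moreover have "cmod (\<tau> - z) < r" using that by (simp add: dist_norm)
    ultimately show ?thesis by (simp add: r_def field_simps)
  qed
  have disc: "ball \<tau> r \<subseteq> unit_disc" using sub r by fastforce
  have "open (h ` ball \<tau> r)"
    using disc by (intro open_mapping_thm3 holomorphic_on_subset[OF hol] inj_on_subset[OF inj]) auto
  moreover have "0 \<in> h ` ball \<tau> r" using \<tau>(2) r by force
  ultimately obtain m where m: "m > 0" "ball 0 m \<subseteq> h ` ball \<tau> r"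
    by (meson open_contains_ball)
  have "m \<le> cmod (h z)" if z: "z \<in> unit_disc" "1 - r < cmod z" for z
  proof (rule ccontr)
    assume "\<not> m \<le> cmod (h z)"
    then obtain w where w: "w \<in> ball \<tau> r" "h z = h w" using m(2) by force
    then have "z = w" using inj disc z(1) by (metis inj_onD subsetD)
    then show False using sub[OF w(1)] z(2) by simp
  qed
  moreover have "eventually (\<lambda>z. 1 - r < cmod z) (at x within stolz_angle x R)"
    using x r by (intro order_tendstoD(1)[OF tendsto_norm[OF tendsto_ident_at]]) auto
  then have "eventually (\<lambda>z. z \<in> unit_disc \<and> 1 - r < cmod z) (at x within stolz_angle x R)"
    using eventually_in_stolz_angle
    by eventually_elim (use stolz_angle_subset_disc in blast)
  ultimately have "eventually (\<lambda>z. m \<le> cmod (h z)) (at x within stolz_angle x R)"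
    by (auto elim: eventually_mono)
  with m(1) show ?thesis by (rule that)
qed

theorem theorem1p1:
  fixes \<phi> :: "real \<Rightarrow> complex \<Rightarrow> complex" and G h :: "complex \<Rightarrow> complex" and x :: complex
  assumes "holomorphic_semigroup \<phi>"
    and "generator_of \<phi> G"
    and "\<exists>z\<in>unit_disc. G z \<noteq> 0"
    and "koenigs_function G h"
    and "x \<in> sphere 0 1"
  shows "(regular_pole G x \<longleftrightarrow> (\<exists>t>0. beta_point (\<phi> t) x)) \<and>
         ((\<exists>t>0. beta_point (\<phi> t) x) \<longleftrightarrow> (\<forall>t>0. beta_point (\<phi> t) x)) \<and>
         (regular_pole G x \<longleftrightarrow> beta_point h x)"
proof -
  have x: "cmod x = 1" using assms(5) by simp
  have hol: "h holomorphic_on unit_disc" and inj: "inj_on h unit_disc"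
    using assms(4) by (auto simp: koenigs_function_def)
  obtain \<tau> where dw: "denjoy_wolff_point G \<tau>"
    and norm: "if \<tau> \<in> unit_disc
         then h \<tau> = 0 \<and> deriv h \<tau> = 1 \<and> (\<forall>z\<in>unit_disc. deriv h z * G z = deriv G \<tau> * h z)
         else h 0 = 0 \<and> (\<forall>z\<in>unit_disc. deriv h z * G z = 1)"
    using assms(4) unfolding koenigs_function_def by blast
  obtain p where phol: "p holomorphic_on unit_disc"
    and ppos: "\<And>z. z \<in> unit_disc \<Longrightarrow> 0 \<le> Re (p z)"
    and Gp: "\<And>z. z \<in> unit_disc \<Longrightarrow> G z = (z - \<tau>) * (cnj \<tau> * z - 1) * p z"
    using dw unfolding denjoy_wolff_point_def by blast
  obtain c where c: "c \<ge> 0"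
    and lim: "\<And>R. 1 < R \<Longrightarrow> ((\<lambda>z. G z * (x - z)) \<longlongrightarrow> - of_real c * x\<^sup>2) (at x within stolz_angle x R)"
    using Berkson_Porta_angular_limit[OF phol ppos Gp x] by blast
  have "\<exists>l b m. (l = 0 \<or> b = 0) \<and> (\<forall>z\<in>unit_disc. deriv h z * G z = l * h z + b) \<and> m > 0 \<and>
      eventually (\<lambda>z. m \<le> cmod (l * h z + b)) (at x within stolz_angle x 2)"
  proof (cases "\<tau> \<in> unit_disc")
    case True
    then have h\<tau>: "h \<tau> = 0" and ode: "\<And>z. z \<in> unit_disc \<Longrightarrow> deriv h z * G z = deriv G \<tau> * h z"
      using norm by auto
    \<comment> \<open>Otherwise \<open>h' G\<close> would vanish identically, and \<open>G\<close>
      with it, since an injective \<open>h\<close> has no critical points.\<close>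
    have l: "deriv G \<tau> \<noteq> 0"
    proof
      assume 0: "deriv G \<tau> = 0"
      obtain z where z: "z \<in> unit_disc" "G z \<noteq> 0" using assms(3) by blast
      then show False
        using ode[OF z(1)] 0 holomorphic_injective_imp_regular[OF hol open_ball inj z(1)] by simp
    qed
    obtain m where m: "m > 0" "eventually (\<lambda>z. m \<le> cmod (h z)) (at x within stolz_angle x 2)"
      using injective_holomorphic_bounded_away_from_zero[OF hol inj True h\<tau> x] by blast
    have "eventually (\<lambda>z. cmod (deriv G \<tau>) * m \<le> cmod (deriv G \<tau> * h z + 0)) (at x within stolz_angle x 2)"
      using m(2) by eventually_elim (simp add: norm_mult mult_left_mono)
    moreover have "cmod (deriv G \<tau>) * m > 0" using l m(1) by simp
    moreover have "\<forall>z\<in>unit_disc. deriv h z * G z = deriv G \<tau> * h z + 0" using ode by simp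
    ultimately show ?thesis by blast
  next
    case False
    then have "\<forall>z\<in>unit_disc. deriv h z * G z = 0 * h z + 1" using norm by simp
    moreover have "eventually (\<lambda>z. 1 \<le> cmod (0 * h z + 1)) (at x within stolz_angle x 2)" by simp
    ultimately show ?thesis using zero_less_one by blast
  qed
  then obtain l b m where lb: "l = 0 \<or> b = 0"
    and ode: "\<And>z. z \<in> unit_disc \<Longrightarrow> deriv h z * G z = l * h z + b"
    and m: "m > 0" "eventually (\<lambda>z. m \<le> cmod (l * h z + b)) (at x within stolz_angle x 2)"
    by blast
  interpret koenigs_model \<phi> G h l b x c
    using assms(1,2) hol inj ode lb x c lim by unfold_locales
  have two: "1 < (2::real)" by simp
  have pole: "regular_pole G x \<longleftrightarrow> c > 0"
    by (rule regular_pole_iff_angular_limit[OF x c lim])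
  have h_pole: "c > 0" if "beta_point h x"
    using beta_point_derivative_bound[OF x two that] pole_if_koenigs_derivative_small[OF two m] by metis
  have \<phi>_pole: "c > 0" if t: "t > 0" and \<beta>: "beta_point (\<phi> t) x" for t
  proof -
    obtain L where "L \<ge> 0"
      "eventually (\<lambda>z. cmod (deriv (\<phi> t) z) \<le> L * cmod (x - z)) (at x within stolz_angle x 2)"
      using beta_point_derivative_bound[OF x two \<beta>] by blast
    then obtain L' where
      "eventually (\<lambda>z. cmod (deriv h z) \<le> L' * cmod (x - z)) (at x within stolz_angle x 2)"
      using koenigs_derivative_small_if_semigroup_derivative_small[OF two less_imp_le[OF t]] by blast
    then show ?thesis by (rule pole_if_koenigs_derivative_small[OF two m])
  qed
  \<comment> \<open>Every condition is equivalent to \<open>c > 0\<close>; the time 1 witnesses the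
    passage from all \<open>t\<close> to some \<open>t\<close>.\<close>
  show ?thesis
    using pole h_pole \<phi>_pole beta_point_koenigs beta_point_semigroup zero_less_one by metis
qed

end
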